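(* Let $U$ be an open subset of $\mathbb{C}$ containing $0$. Let $A$ and $B$ be complex unital Banach algebras, and let $\pi : U \to \mathcal{B}(A,B)$ be an analytic map such that for every $\lambda \in U$ the value $\pi(\lambda)$ is a (unital, continuous) algebra homomorphism $A \to B$, and such that $\pi(0)$ is surjective. Suppose that for each $x \in \operatorname{Ker}\pi(0)$ we have $\sigma(x) = \{0\}$. Let $q_1, \dots, q_n : U \to E(B)$ be finitely many analytic maps such that for all $i \neq j$ and each $\lambda \in U$ the idempotents $q_i(\lambda)$ and $q_j(\lambda)$ are orthogonal. Then there exist an open set $V \subset \mathbb{C}$ with $0 \in V \subset U$ and analytic maps $p_1, \dots, p_n : V \to E(A)$ such that for all $i \neq j$ and each $\lambda \in V$ the idempotents $p_i(\lambda)$ and $p_j(\lambda)$ are orthogonal, and such that $\pi(\lambda)p_i(\lambda) = q_i(\lambda)$ for each $i \in \{1,\dots,n\}$ and each $\lambda \in V$.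
   Context: All Banach algebras are over $\mathbb{C}$ and unital; all Banach algebra homomorphisms are continuous and preserve $1$. $\mathcal{B}(A,B)$ is the Banach space of bounded linear operators from $A$ to $B$ (with the operator norm). For a Banach algebra $A$, $E(A) = \{p \in A : p^2 = p\}$ is the set of idempotents. An analytic map into $E(A)$ (or $E(B)$) is an analytic map into the Banach space $A$ (or $B$) with values in that subset. Two idempotents $e, f$ are orthogonal if $ef = fe = 0$. $\sigma(x)$ denotes the spectrum of $x$; for $x \in \operatorname{Ker}\pi(0) \subset A$ it is taken with respect to $A$. *)

theory Defs
  imports "HOL-Complex_Analysis.Complex_Analysis"
begin

class scaleC =
  fixes scaleC :: "complex \<Rightarrow> 'a \<Rightarrow> 'a" (infixr "*\<^sub>C" 75)

class complex_banach = banach + scaleC +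
  assumes scaleC_add_right: "c *\<^sub>C (x + y) = c *\<^sub>C x + c *\<^sub>C y"
    and scaleC_add_left: "(c + d) *\<^sub>C x = c *\<^sub>C x + d *\<^sub>C x"
    and scaleC_scaleC: "c *\<^sub>C (d *\<^sub>C x) = (c * d) *\<^sub>C x"
    and scaleC_of_real: "complex_of_real r *\<^sub>C x = r *\<^sub>R x"
    and norm_scaleC: "norm (c *\<^sub>C x) = cmod c * norm x"

(* As usual, the unit of a complex unital Banach algebra has norm 1; this is part of
   real_normed_algebra_1. *)
class complex_banach_algebra_1 = complex_banach + real_normed_algebra_1 +
  assumes mult_scaleC_left: "(c *\<^sub>C x) * y = c *\<^sub>C (x * y)"
    and mult_scaleC_right: "x * (c *\<^sub>C y) = c *\<^sub>C (x * y)"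

instantiation complex :: complex_banach_algebra_1
begin

definition scaleC_complex :: "complex \<Rightarrow> complex \<Rightarrow> complex" where
  "scaleC_complex c x = c * x"

instance
  by standard (simp_all add: scaleC_complex_def algebra_simps norm_mult scaleR_conv_of_real)

end

lemma bounded_linear_scaleC: "bounded_linear (\<lambda>x::'a::complex_banach. c *\<^sub>C x)"
proof (rule bounded_linear_intro)
  show "c *\<^sub>C (x + y) = c *\<^sub>C x + c *\<^sub>C y" for x y :: 'a
    by (rule scaleC_add_right)
  show "c *\<^sub>C (r *\<^sub>R x) = r *\<^sub>R (c *\<^sub>C x)" for r and x :: 'a
    by (simp add: scaleC_of_real[symmetric] scaleC_scaleC mult.commute)
  show "norm (c *\<^sub>C x) \<le> norm x * cmod c" for x :: 'a
    by (simp add: norm_scaleC mult.commute)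
qed

(* The bounded real-linear operators into a complex Banach space form a complex Banach space
   under the pointwise operations and the operator norm. The bounded complex-linear operators
   B(A,B) are a closed complex subspace of it, with the same norm; hence an analytic map into
   B(A,B) is an analytic map into this type whose values are complex-linear. *)
instantiation blinfun :: (real_normed_vector, complex_banach) complex_banach
begin

lift_definition scaleC_blinfun :: "complex \<Rightarrow> 'a \<Rightarrow>\<^sub>L 'b \<Rightarrow> 'a \<Rightarrow>\<^sub>L 'b"
  is "\<lambda>c f x. c *\<^sub>C f x"
  by (rule bounded_linear_compose[OF bounded_linear_scaleC])

instance
proof
  fix c d :: complex and r :: real and f g :: "'a \<Rightarrow>\<^sub>L 'b"
  show "c *\<^sub>C (f + g) = c *\<^sub>C f + c *\<^sub>C g"
    by transfer (simp add: scaleC_add_right)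
  show "(c + d) *\<^sub>C f = c *\<^sub>C f + d *\<^sub>C f"
    by transfer (simp add: scaleC_add_left)
  show "c *\<^sub>C (d *\<^sub>C f) = (c * d) *\<^sub>C f"
    by transfer (simp add: scaleC_scaleC)
  show "complex_of_real r *\<^sub>C f = r *\<^sub>R f"
    by transfer (simp add: scaleC_of_real)
  have le: "norm (c *\<^sub>C f) \<le> cmod c * norm f" for c :: complex and f :: "'a \<Rightarrow>\<^sub>L 'b"
  proof (rule norm_blinfun_bound)
    show "norm (blinfun_apply (c *\<^sub>C f) x) \<le> cmod c * norm f * norm x" for x
      by (simp add: scaleC_blinfun.rep_eq norm_scaleC mult.assoc mult_left_mono norm_blinfun)
  qed simp
  show "norm (c *\<^sub>C f) = cmod c * norm f"
  proof (cases "c = 0")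
    case True
    then show ?thesis using le[of c f] by simp
  next
    case False
    have "inverse c *\<^sub>C c *\<^sub>C f = f"
      using False by transfer (simp add: scaleC_scaleC scaleC_of_real[of 1, simplified])
    then have "norm f \<le> cmod (inverse c) * norm (c *\<^sub>C f)"
      using le[of "inverse c" "c *\<^sub>C f"] by simp
    then have "cmod c * norm f \<le> cmod c * (cmod (inverse c) * norm (c *\<^sub>C f))"
      by (intro mult_left_mono) simp_all
    also have "\<dots> = norm (c *\<^sub>C f)"
      using False by (simp add: norm_inverse)
    finally have "cmod c * norm f \<le> norm (c *\<^sub>C f)" .
    then show ?thesis using le[of c f] by simp
  qed
qed

end

(* Used only for open S, so the disc of convergence may be shrunk to lie inside S. *)
definition analytic_map_on :: "(complex \<Rightarrow> 'e::complex_banach) \<Rightarrow> complex set \<Rightarrow> bool" where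
  "analytic_map_on f S \<longleftrightarrow>
    (\<forall>z\<in>S. \<exists>r>0. \<exists>a. \<forall>w\<in>ball z r. (\<lambda>k. (w - z) ^ k *\<^sub>C a k) sums f w)"

lemma analytic_map_on_complex:
  fixes f :: "complex \<Rightarrow> complex"
  shows "analytic_map_on f S \<longleftrightarrow> f analytic_on S"
proof -
  have "(\<exists>a. \<forall>w\<in>ball z r. (\<lambda>k. (w - z) ^ k *\<^sub>C a k) sums f w) \<longleftrightarrow> f holomorphic_on ball z r" for z r
  proof
    assume "\<exists>a. \<forall>w\<in>ball z r. (\<lambda>k. (w - z) ^ k *\<^sub>C a k) sums f w"
    then obtain a where "\<forall>w\<in>ball z r. (\<lambda>k. (w - z) ^ k *\<^sub>C a k) sums f w"
      by blast
    then have "(\<lambda>k. a k * (w - z) ^ k) sums f w" if "w \<in> ball z r" for w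
      using that by (simp add: scaleC_complex_def mult.commute)
    then show "f holomorphic_on ball z r"
      by (rule power_series_holomorphic)
  next
    assume "f holomorphic_on ball z r"
    from holomorphic_power_series[OF this]
    show "\<exists>a. \<forall>w\<in>ball z r. (\<lambda>k. (w - z) ^ k *\<^sub>C a k) sums f w"
      by (intro exI[of _ "\<lambda>k. (deriv ^^ k) f z / fact k"])
        (auto simp: scaleC_complex_def mult.commute)
  qed
  then show ?thesis
    by (simp add: analytic_map_on_def analytic_on_def)
qed

definition unital_algebra_hom ::
  "('a::complex_banach_algebra_1 \<Rightarrow> 'b::complex_banach_algebra_1) \<Rightarrow> bool" where
  "unital_algebra_hom f \<longleftrightarrow>
    (\<forall>x y. f (x + y) = f x + f y) \<and> (\<forall>c x. f (c *\<^sub>C x) = c *\<^sub>C f x) \<and>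
    (\<forall>x y. f (x * y) = f x * f y) \<and> f 1 = 1"

definition idempotents :: "'a::complex_banach_algebra_1 set" where
  "idempotents = {p. p\<^sup>2 = p}"

definition orthogonal_idempotents :: "'a::complex_banach_algebra_1 \<Rightarrow> 'a \<Rightarrow> bool" where
  "orthogonal_idempotents e f \<longleftrightarrow> e * f = 0 \<and> f * e = 0"

definition algebra_spectrum :: "'a::complex_banach_algebra_1 \<Rightarrow> complex set" where
  "algebra_spectrum x = {c. \<not> (\<exists>y. (c *\<^sub>C 1 - x) * y = 1 \<and> y * (c *\<^sub>C 1 - x) = 1)}"

end

theory Submission
  imports Defs
begin

text \<open>
  One idempotent \<open>q\<close> is lifted in two steps. Since \<open>\<pi>(0)\<close> is open, a geometric iteration on power
  series solves \<open>\<pi> f = q\<close> near \<open>0\<close> with \<open>f\<close> analytic. Then \<open>g = f\<^sup>2 - f\<close> is in the kernel of \<open>\<pi>\<close>, so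
  \<open>g(0)\<close> is quasinilpotent, the binomial series \<open>h = (1 + 4g)\<^bsup>-1/2\<^esup>\<close> converges near \<open>0\<close>, and
  \<open>p = (1 + (2f - 1) h) / 2\<close> is an idempotent with \<open>\<pi> p = (1 + (2q - 1)) / 2 = q\<close>. For several idempotents,
  let \<open>e\<close> be the sum of the lifts already found and replace \<open>f\<close> by \<open>(1 - e) f (1 - e)\<close>, which still
  lifts \<open>q\<close>; the resulting \<open>p\<close> is annihilated by \<open>e\<close> on both sides. That some power of a
  quasinilpotent element has norm below \<open>1\<close> is proved by Rickart's elementary argument, which averages the
  resolvent over roots of unity instead of using Cauchy's integral formula.
\<close>

subsection \<open>Scalar multiplication\<close>

lemma scaleC_zero_left [simp]: "0 *\<^sub>C (x::'a::complex_banach) = 0"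
  using scaleC_of_real[of 0 x] by simp

lemma scaleC_one [simp]: "1 *\<^sub>C (x::'a::complex_banach) = x"
  using scaleC_of_real[of 1 x] by simp

lemma scaleC_zero_right [simp]: "c *\<^sub>C (0::'a::complex_banach) = 0"
  by (rule linear_0[OF bounded_linear.linear[OF bounded_linear_scaleC]])

lemma scaleC_diff_right: "c *\<^sub>C (x - y) = c *\<^sub>C x - c *\<^sub>C (y::'a::complex_banach)"
  by (rule linear_diff[OF bounded_linear.linear[OF bounded_linear_scaleC]])

lemma scaleC_minus_left: "(- c) *\<^sub>C x = - (c *\<^sub>C (x::'a::complex_banach))"
  using scaleC_add_left[of "-c" c x] by (intro eq_neg_iff_add_eq_0[THEN iffD2]) simp

lemma scaleC_diff_left: "(c - d) *\<^sub>C x = c *\<^sub>C x - d *\<^sub>C (x::'a::complex_banach)"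
  using scaleC_add_left[of c "-d" x] by (simp add: scaleC_minus_left)

lemma power_scaleC: "(c *\<^sub>C x) ^ k = c ^ k *\<^sub>C (x::'a::complex_banach_algebra_1) ^ k"
  by (induction k) (simp_all add: mult_scaleC_left mult_scaleC_right scaleC_scaleC mult.commute)

lemma bounded_linear_scaleC_left: "bounded_linear (\<lambda>c. c *\<^sub>C (x::'a::complex_banach))"
proof (rule bounded_linear_intro[where K = "norm x"])
  show "(s *\<^sub>R c) *\<^sub>C x = s *\<^sub>R c *\<^sub>C x" for s c
    by (simp only: scaleR_conv_of_real flip: scaleC_scaleC scaleC_of_real)
qed (simp_all add: scaleC_add_left norm_scaleC)

subsection \<open>Absolutely convergent power series on a disc\<close>

text \<open>The least such \<open>M\<close> is a weighted \<open>\<ell>\<^sup>1\<close> norm of the coefficients, which is submultiplicative.\<close>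

definition ps_bounded :: "real \<Rightarrow> real \<Rightarrow> (complex \<Rightarrow> 'e::complex_banach) \<Rightarrow> bool" where
  "ps_bounded r M f \<longleftrightarrow> (\<exists>a s. ((\<lambda>k. norm (a k) * r ^ k) has_sum s) UNIV \<and> s \<le> M \<and>
    (\<forall>w\<in>cball 0 r. ((\<lambda>k. w ^ k *\<^sub>C a k) has_sum f w) UNIV))"

lemma ps_boundedI:
  assumes "((\<lambda>k. norm (a k) * r ^ k) has_sum s) UNIV" and "s \<le> M"
    and "\<And>w. w \<in> cball 0 r \<Longrightarrow> ((\<lambda>k. w ^ k *\<^sub>C a k) has_sum f w) UNIV"
  shows "ps_bounded r M f"
  unfolding ps_bounded_def using assms by (intro exI[of _ a] exI[of _ s] conjI ballI)

lemma ps_boundedE: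
  assumes "ps_bounded r M f"
  obtains a s where "((\<lambda>k. norm (a k) * r ^ k) has_sum s) UNIV" and "s \<le> M"
    and "\<And>w. w \<in> cball 0 r \<Longrightarrow> ((\<lambda>k. w ^ k *\<^sub>C a k) has_sum f w) UNIV"
proof -
  from assms obtain a s where "((\<lambda>k. norm (a k) * r ^ k) has_sum s) UNIV" "s \<le> M"
    "\<forall>w\<in>cball 0 r. ((\<lambda>k. w ^ k *\<^sub>C a k) has_sum f w) UNIV"
    unfolding ps_bounded_def by (elim exE conjE)
  then show thesis
    by (intro that[of a s]) (assumption | erule (1) bspec)+
qed

lemma ps_bounded_cong:
  assumes "ps_bounded r M f" and "\<And>w. w \<in> cball 0 r \<Longrightarrow> f w = g w"
  shows "ps_bounded r M g"
  using assms(1)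
proof (rule ps_boundedE)
  fix a s assume a: "((\<lambda>k. norm (a k) * r ^ k) has_sum s) UNIV" "s \<le> M"
    "\<And>w. w \<in> cball 0 r \<Longrightarrow> ((\<lambda>k. w ^ k *\<^sub>C a k) has_sum f w) UNIV"
  show "ps_bounded r M g"
    by (rule ps_boundedI[OF a(1,2)]) (simp only: a(3) flip: assms(2))
qed

lemma ps_bounded_mono: "ps_bounded r M f \<Longrightarrow> M \<le> N \<Longrightarrow> ps_bounded r N f"
  unfolding ps_bounded_def using order_trans by (elim exE conjE) (intro exI conjI)

lemma norm_powser_term_le:
  assumes "w \<in> cball 0 r"
  shows "norm (w ^ k *\<^sub>C (x::'a::complex_banach)) \<le> norm x * r ^ k"
proof -
  have "norm w ^ k \<le> r ^ k"
    using assms by (intro power_mono) auto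
  then show ?thesis
    by (simp add: norm_scaleC norm_power mult.commute mult_left_mono)
qed

lemma norm_has_sum_le:
  fixes f :: "'i \<Rightarrow> 'a::real_normed_vector"
  assumes "(f has_sum x) A" and "(g has_sum M) A" and "\<And>i. i \<in> A \<Longrightarrow> norm (f i) \<le> g i"
  shows "norm x \<le> M"
proof -
  have n: "(\<lambda>i. norm (f i)) summable_on A"
    using has_sum_imp_summable[OF assms(2)] assms(3)
    by (rule summable_on_comparison_test) simp_all
  have "norm x = norm (infsum f A)"
    by (simp only: infsumI[OF assms(1)])
  also have "\<dots> \<le> infsum (\<lambda>i. norm (f i)) A"
    by (rule norm_infsum_bound[OF n])
  also have "\<dots> \<le> M"
    by (rule has_sum_mono[OF has_sum_infsum[OF n] assms(2,3)])
  finally show ?thesis .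
qed

text \<open>A dominated nonnegative family is summable with a sum no larger than that of its
  majorant. Closure proofs below therefore only exhibit coefficients, a majorant \<open>g\<close>
  and the pointwise expansion.\<close>

lemma ps_bounded_comparison:
  assumes "(g has_sum s) UNIV" and "\<And>k. norm (a k) * r ^ k \<le> g k" and "0 \<le> r"
    and "\<And>w. w \<in> cball 0 r \<Longrightarrow> ((\<lambda>k. w ^ k *\<^sub>C a k) has_sum f w) UNIV"
  shows "ps_bounded r s f"
proof -
  have "(\<lambda>k. norm (a k) * r ^ k) summable_on UNIV"
    using has_sum_imp_summable[OF assms(1)] assms(2)
    by (rule summable_on_comparison_test) (use assms(3) in simp)
  then have n: "((\<lambda>k. norm (a k) * r ^ k) has_sum infsum (\<lambda>k. norm (a k) * r ^ k) UNIV) UNIV"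
    by (rule has_sum_infsum)
  show ?thesis
    by (rule ps_boundedI[OF n has_sum_mono[OF n assms(1,2)] assms(4)])
qed

lemma ps_bounded_norm_le:
  assumes "ps_bounded r M f" and "w \<in> cball 0 r"
  shows "norm (f w) \<le> M"
proof -
  obtain a s where a: "((\<lambda>k. norm (a k) * r ^ k) has_sum s) UNIV" "s \<le> M"
    "((\<lambda>k. w ^ k *\<^sub>C a k) has_sum f w) UNIV"
    using ps_boundedE[OF assms(1)] assms(2) by metis
  have "norm (f w) \<le> s"
    using a(3,1) norm_powser_term_le[OF assms(2)] by (rule norm_has_sum_le)
  then show ?thesis using a(2) by simp
qed

lemma ps_bounded_nonneg: "ps_bounded r M f \<Longrightarrow> 0 \<le> r \<Longrightarrow> 0 \<le> M"
  by (rule order_trans[OF norm_ge_zero ps_bounded_norm_le[of r M f 0]]) simp_all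

lemma ps_bounded_monom: "ps_bounded r (norm x * r ^ j) (\<lambda>w. w ^ j *\<^sub>C x)"
proof (rule ps_boundedI)
  let ?a = "\<lambda>k. if k = j then x else 0"
  show "((\<lambda>k. norm (?a k) * r ^ k) has_sum (norm x * r ^ j)) UNIV"
    by (rule has_sum_finite_neutralI[where B = "{j}"]) auto
  show "((\<lambda>k. w ^ k *\<^sub>C ?a k) has_sum (w ^ j *\<^sub>C x)) UNIV" for w
    by (rule has_sum_finite_neutralI[where B = "{j}"]) auto
qed simp

lemma ps_bounded_const: "ps_bounded r (norm x) (\<lambda>w. x)"
  using ps_bounded_monom[of r x 0] by simp

section \<open>Closure under sums, changes of radius, linear maps, series and products\<close>

lemma ps_bounded_add:
  assumes "ps_bounded r M f" and "ps_bounded r N g" and "0 \<le> r"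
  shows "ps_bounded r (M + N) (\<lambda>w. f w + g w)"
proof -
  obtain a s where a: "((\<lambda>k. norm (a k) * r ^ k) has_sum s) UNIV" "s \<le> M"
    "\<And>w. w \<in> cball 0 r \<Longrightarrow> ((\<lambda>k. w ^ k *\<^sub>C a k) has_sum f w) UNIV"
    using ps_boundedE[OF assms(1)] by metis
  obtain b t where b: "((\<lambda>k. norm (b k) * r ^ k) has_sum t) UNIV" "t \<le> N"
    "\<And>w. w \<in> cball 0 r \<Longrightarrow> ((\<lambda>k. w ^ k *\<^sub>C b k) has_sum g w) UNIV"
    using ps_boundedE[OF assms(2)] by metis
  have "ps_bounded r (s + t) (\<lambda>w. f w + g w)"
  proof (rule ps_bounded_comparison)
    show "((\<lambda>k. norm (a k) * r ^ k + norm (b k) * r ^ k) has_sum (s + t)) UNIV"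
      using a(1) b(1) by (rule has_sum_add)
    show "norm (a k + b k) * r ^ k \<le> norm (a k) * r ^ k + norm (b k) * r ^ k" for k
      using assms(3) by (simp flip: distrib_right add: mult_right_mono norm_triangle_ineq)
    show "((\<lambda>k. w ^ k *\<^sub>C (a k + b k)) has_sum (f w + g w)) UNIV" if "w \<in> cball 0 r" for w
      using has_sum_add[OF a(3)[OF that] b(3)[OF that]] by (simp add: scaleC_add_right)
  qed (rule assms(3))
  then show ?thesis
    using add_mono[OF a(2) b(2)] by (rule ps_bounded_mono)
qed

lemma ps_bounded_sum:
  assumes "finite I" and "\<And>i. i \<in> I \<Longrightarrow> ps_bounded r (M i) (f i)" and "0 \<le> r"
  shows "ps_bounded r (\<Sum>i\<in>I. M i) (\<lambda>w. \<Sum>i\<in>I. f i w)"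
  using assms
proof (induction I rule: finite_induct)
  case empty
  then show ?case using ps_bounded_const[of r 0] by simp
next
  case (insert i I)
  then show ?case by (simp add: ps_bounded_add)
qed

lemma ps_bounded_radius_mono:
  assumes "ps_bounded r M f" and "0 \<le> r'" and "r' \<le> r"
  shows "ps_bounded r' M f"
proof -
  obtain a s where a: "((\<lambda>k. norm (a k) * r ^ k) has_sum s) UNIV" "s \<le> M"
    "\<And>w. w \<in> cball 0 r \<Longrightarrow> ((\<lambda>k. w ^ k *\<^sub>C a k) has_sum f w) UNIV"
    using ps_boundedE[OF assms(1)] by metis
  have "norm (a k) * r' ^ k \<le> norm (a k) * r ^ k" for k
    using assms(2,3) by (intro mult_left_mono power_mono) auto
  with a(1) have "ps_bounded r' s f"
    by (rule ps_bounded_comparison) (use assms(2,3) a(3) in auto)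
  then show ?thesis using a(2) by (rule ps_bounded_mono)
qed

text \<open>Passing from radius \<open>r\<close> to \<open>t * r\<close> multiplies the
  \<open>k\<close>-th weighted coefficient by \<open>t ^ k\<close>, which is at most
  \<open>t\<close> for positive \<open>k\<close>; only the constant coefficient \<open>f 0\<close>
  keeps its size. This is the source of all smallness near \<open>0\<close>.\<close>

lemma ps_bounded_shrink:
  assumes "ps_bounded r M f" and "0 \<le> r" and "0 \<le> t" and "t \<le> 1"
  shows "ps_bounded (t * r) (norm (f 0) + t * M) f"
proof -
  obtain a s where a: "((\<lambda>k. norm (a k) * r ^ k) has_sum s) UNIV" "s \<le> M"
    "\<And>w. w \<in> cball 0 r \<Longrightarrow> ((\<lambda>k. w ^ k *\<^sub>C a k) has_sum f w) UNIV"
    using ps_boundedE[OF assms(1)] by metis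
  \<comment> \<open>Evaluation at \<open>0\<close>, where \<open>0 ^ 0 = 1\<close>, identifies the
    constant coefficient.\<close>
  have "((\<lambda>k. 0 ^ k *\<^sub>C a k) has_sum a 0) UNIV"
    by (rule has_sum_finite_neutralI[where B = "{0}"]) (auto simp: power_0_left)
  then have a0: "a 0 = f 0"
    using a(3)[of 0] assms(2) has_sum_unique by fastforce
  let ?u = "\<lambda>k. (if k = 0 then norm (a 0) else 0) + t * (norm (a k) * r ^ k)"
  have u: "(?u has_sum (norm (a 0) + t * s)) UNIV"
    by (intro has_sum_add has_sum_cmult_right a has_sum_finite_neutralI[where B = "{0}"]) auto
  have le: "norm (a k) * (t * r) ^ k \<le> ?u k" for k
  proof (cases k)
    case 0
    then show ?thesis using assms by simp
  next
    case (Suc j)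
    have "t ^ k \<le> t" using assms(3,4) unfolding Suc by (simp add: mult_left_le power_le_one)
    then show ?thesis
      using Suc assms mult_right_mono[of "t ^ k" t "norm (a k) * r ^ k"]
      by (simp add: power_mult_distrib mult_ac)
  qed
  have "t * r \<le> r"
    using assms by (simp add: mult_left_le_one_le)
  then have "ps_bounded (t * r) (norm (a 0) + t * s) f"
    by (intro ps_bounded_comparison[OF u le]) (use assms a(3) in auto)
  moreover have "norm (a 0) + t * s \<le> norm (f 0) + t * M"
    using a(2) assms(3) a0 by (simp add: mult_left_mono)
  ultimately show ?thesis by (rule ps_bounded_mono)
qed

lemma ps_bounded_linear:
  assumes "ps_bounded r M f" and "bounded_linear T" and "\<And>c x. T (c *\<^sub>C x) = c *\<^sub>C T x"
    and "\<And>x. norm (T x) \<le> K * norm x" and "0 \<le> K" and "0 \<le> r"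
  shows "ps_bounded r (K * M) (\<lambda>w. T (f w))"
proof -
  obtain a s where a: "((\<lambda>k. norm (a k) * r ^ k) has_sum s) UNIV" "s \<le> M"
    "\<And>w. w \<in> cball 0 r \<Longrightarrow> ((\<lambda>k. w ^ k *\<^sub>C a k) has_sum f w) UNIV"
    using ps_boundedE[OF assms(1)] by metis
  have "ps_bounded r (K * s) (\<lambda>w. T (f w))"
  proof (rule ps_bounded_comparison)
    show "((\<lambda>k. K * (norm (a k) * r ^ k)) has_sum (K * s)) UNIV"
      by (intro has_sum_cmult_right a)
    show "norm (T (a k)) * r ^ k \<le> K * (norm (a k) * r ^ k)" for k
      using mult_right_mono[OF assms(4)[of "a k"], of "r ^ k"] assms(6) by (simp add: mult.assoc)
    show "((\<lambda>k. w ^ k *\<^sub>C T (a k)) has_sum T (f w)) UNIV" if "w \<in> cball 0 r" for w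
      using has_sum_bounded_linear[OF assms(2) a(3)[OF that]] by (simp add: assms(3))
  qed (rule assms(6))
  then show ?thesis
    using mult_left_mono[OF a(2) assms(5)] by (rule ps_bounded_mono)
qed

lemma ps_bounded_scaleC:
  assumes "ps_bounded r M f" and "0 \<le> r"
  shows "ps_bounded r (cmod c * M) (\<lambda>w. c *\<^sub>C f w)"
  by (rule ps_bounded_linear[OF assms(1) bounded_linear_scaleC])
    (simp_all add: assms scaleC_scaleC norm_scaleC mult.commute)

lemma ps_bounded_minus: "ps_bounded r M f \<Longrightarrow> 0 \<le> r \<Longrightarrow> ps_bounded r M (\<lambda>w. - f w)"
  using ps_bounded_scaleC[of r M f "-1"] by (simp add: scaleC_minus_left)

lemma ps_bounded_diff:
  "ps_bounded r M f \<Longrightarrow> ps_bounded r N g \<Longrightarrow> 0 \<le> r \<Longrightarrow> ps_bounded r (M + N) (\<lambda>w. f w - g w)"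
  using ps_bounded_add[of r M f N "\<lambda>w. - g w"] ps_bounded_minus[of r N g] by simp

text \<open>Completeness of the weighted norm: the double family of coefficients is absolutely
  summable with total at most \<open>S\<close>, so both orders of summation agree, and the
  \<open>k\<close>-th coefficient of \<open>F\<close> is the sum over \<open>m\<close> of the
  \<open>k\<close>-th coefficients of \<open>f m\<close>.\<close>

lemma ps_bounded_has_sum:
  assumes "0 < r" and "\<And>m::nat. ps_bounded r (M m) (f m)" and "(M has_sum S) UNIV"
    and "\<And>w. w \<in> cball 0 r \<Longrightarrow> ((\<lambda>m. f m w) has_sum F w) UNIV"
  shows "ps_bounded r S F"
proof -
  have "\<forall>m. \<exists>a s. ((\<lambda>k. norm (a k) * r ^ k) has_sum s) UNIV \<and> s \<le> M m \<and>
    (\<forall>w\<in>cball 0 r. ((\<lambda>k. w ^ k *\<^sub>C a k) has_sum f m w) UNIV)"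
    using assms(2) unfolding ps_bounded_def by blast
  then obtain a s where a: "\<And>m. ((\<lambda>k. norm (a m k) * r ^ k) has_sum s m) UNIV"
    and s: "\<And>m. s m \<le> M m"
    and f: "\<And>m w. w \<in> cball 0 r \<Longrightarrow> ((\<lambda>k. w ^ k *\<^sub>C a m k) has_sum f m w) UNIV"
    by metis
  let ?n = "\<lambda>(m, k). norm (a m k) * r ^ k"
  have s0: "0 \<le> s m" for m
    using a[of m] by (rule has_sum_nonneg) (use assms(1) in simp)
  have "s summable_on UNIV"
    by (rule summable_on_comparison_test[OF has_sum_imp_summable[OF assms(3)]]) (use s s0 in auto)
  then obtain T where T: "(s has_sum T) UNIV" by (auto simp: summable_on_def)
  then have "T \<le> S"
    using assms(3) s by (rule has_sum_mono)
  \<comment> \<open>The nonnegative double family is summed by rows, with total \<open>T\<close>;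
    after the swap the same total is reached by columns, whose sums are the
    \<open>t k\<close>.\<close>
  have "?n summable_on UNIV \<times> UNIV"
    by (rule summable_on_SigmaI) (use a T assms(1) in \<open>auto intro: has_sum_imp_summable\<close>)
  then have n: "(?n has_sum T) (UNIV \<times> UNIV)"
    by (rule has_sum_SigmaI[rotated 2]) (use a T in auto)
  then have n': "((\<lambda>(k, m). norm (a m k) * r ^ k) has_sum T) (UNIV \<times> UNIV)"
    by (subst (asm) has_sum_swap) simp
  have "(\<lambda>m. norm (a m k) * r ^ k) summable_on UNIV" for k
    using summable_on_SigmaD1[OF has_sum_imp_summable[OF n'], of k] by simp
  then obtain t where t: "\<And>k. ((\<lambda>m. norm (a m k) * r ^ k) has_sum t k) UNIV"
    unfolding summable_on_def by metis
  have tT: "(t has_sum T) UNIV"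
    by (rule has_sum_SigmaD[OF n']) (use t in simp)
  \<comment> \<open>Since \<open>r\<close> is positive, the weight \<open>r ^ k\<close> can be
    divided out, and the column \<open>k\<close> of coefficients converges absolutely to some
    \<open>b k\<close>.\<close>
  have "(\<lambda>m. norm (a m k)) summable_on UNIV" for k
    using has_sum_cmult_left[OF t, of k "1 / r ^ k"] assms(1) by (auto simp: summable_on_def)
  then have "(\<lambda>m. a m k) summable_on UNIV" for k
    by (rule abs_summable_summable)
  then obtain b where b: "\<And>k. ((\<lambda>m. a m k) has_sum b k) UNIV"
    unfolding summable_on_def by metis
  have bt: "norm (b k) * r ^ k \<le> t k" for k
  proof -
    have "norm (b k) \<le> t k * (1 / r ^ k)"
      by (rule norm_has_sum_le[OF b has_sum_cmult_left[OF t]]) (use assms(1) in simp)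
    then show ?thesis using assms(1) by (simp add: field_simps)
  qed
  have "ps_bounded r T F"
  proof (rule ps_bounded_comparison[OF tT bt])
    show "0 \<le> r" using assms(1) by simp
    fix w assume w: "w \<in> cball (0::complex) r"
    let ?c = "\<lambda>(m, k). w ^ k *\<^sub>C a m k"
    \<comment> \<open>On the closed disc the terms are dominated by \<open>?n\<close>. Summed by
      rows they give \<open>F w\<close>, by columns the power series with coefficients
      \<open>b\<close>.\<close>
    have "?c summable_on UNIV \<times> UNIV"
      by (rule abs_summable_summable, rule Infinite_Sum.abs_summable_on_comparison_test'[OF has_sum_imp_summable[OF n]])
        (use norm_powser_term_le[OF w] in auto)
    then obtain Z where Z: "(?c has_sum Z) (UNIV \<times> UNIV)"
      by (auto simp: summable_on_def)
    have "((\<lambda>m. f m w) has_sum Z) UNIV"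
      by (rule has_sum_SigmaD[OF Z]) (use f[OF w] in simp)
    then have "Z = F w"
      using assms(4)[OF w] by (rule has_sum_unique)
    moreover have "((\<lambda>(k, m). w ^ k *\<^sub>C a m k) has_sum Z) (UNIV \<times> UNIV)"
      using Z by (subst (asm) has_sum_swap) simp
    then have "((\<lambda>k. w ^ k *\<^sub>C b k) has_sum Z) UNIV"
      by (rule has_sum_SigmaD) (use has_sum_bounded_linear[OF bounded_linear_scaleC b] in simp)
    ultimately show "((\<lambda>k. w ^ k *\<^sub>C b k) has_sum F w) UNIV" by simp
  qed
  then show ?thesis using \<open>T \<le> S\<close> by (rule ps_bounded_mono)
qed

text \<open>Multiplication by \<open>w ^ j\<close> moves every coefficient up by \<open>j\<close>
  places, which multiplies the weighted sum by exactly \<open>r ^ j\<close>.\<close>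

lemma ps_bounded_shift:
  assumes "ps_bounded r M f" and "0 \<le> r"
  shows "ps_bounded r (r ^ j * M) (\<lambda>w. w ^ j *\<^sub>C f w)"
proof -
  obtain a s where a: "((\<lambda>k. norm (a k) * r ^ k) has_sum s) UNIV" "s \<le> M"
    "\<And>w. w \<in> cball 0 r \<Longrightarrow> ((\<lambda>k. w ^ k *\<^sub>C a k) has_sum f w) UNIV"
    using ps_boundedE[OF assms(1)] by metis
  define b where "b k = (if k < j then 0 else a (k - j))" for k
  \<comment> \<open>A family that vanishes below \<open>j\<close> has the same sum as its shift;
    this serves both the weighted norms and the values.\<close>
  have *: "(h has_sum x) UNIV" if "((\<lambda>k. h (k + j)) has_sum x) UNIV" "\<And>k. k < j \<Longrightarrow> h k = 0"
    for h :: "nat \<Rightarrow> 'x::real_normed_vector" and x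
  proof -
    have "(h has_sum x) ((\<lambda>k. k + j) ` UNIV)"
      using that(1) by (subst has_sum_reindex) (auto simp: o_def)
    moreover have "h k = 0" if "k \<notin> range (\<lambda>k. k + j)" for k
      using that \<open>\<And>k. k < j \<Longrightarrow> h k = 0\<close> range_eqI[of k "\<lambda>k. k + j" "k - j"] by fastforce
    ultimately show ?thesis
      by (subst has_sum_cong_neutral[where S = UNIV and T = "range (\<lambda>k. k + j)" and g = h]) auto
  qed
  show ?thesis
  proof (rule ps_boundedI)
    show "((\<lambda>k. norm (b k) * r ^ k) has_sum (r ^ j * s)) UNIV"
      using has_sum_cmult_right[OF a(1), of "r ^ j"]
      by - (rule *, simp_all add: b_def power_add mult_ac)
    show "r ^ j * s \<le> r ^ j * M"
      using a(2) assms(2) by (simp add: mult_left_mono)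
    show "((\<lambda>k. w ^ k *\<^sub>C b k) has_sum (w ^ j *\<^sub>C f w)) UNIV" if "w \<in> cball 0 r" for w
      using has_sum_bounded_linear[OF bounded_linear_scaleC[of "w ^ j"] a(3)[OF that]]
      by - (rule *, simp_all add: b_def power_add scaleC_scaleC mult_ac)
  qed
qed

text \<open>Only \<open>g\<close> is expanded: the summands
  \<open>w ^ m *\<^sub>C B (f w) (b m)\<close> are shifts of linear images of \<open>f\<close>, and
  \<open>ps_bounded_has_sum\<close> adds them up. Complex homogeneity in the second argument is
  asked only at the values \<open>f w\<close>, because a general element of the
  \<open>blinfun\<close> type is merely real-linear.\<close>

lemma ps_bounded_bilinear:
  assumes "0 < r" and f: "ps_bounded r M f" and g: "ps_bounded r N g"
    and B: "bounded_bilinear B" and K: "\<And>x y. norm (B x y) \<le> norm x * norm y"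
    and lin1: "\<And>c x y. B (c *\<^sub>C x) y = c *\<^sub>C B x y"
    and lin2: "\<And>c w y. w \<in> cball 0 r \<Longrightarrow> B (f w) (c *\<^sub>C y) = c *\<^sub>C B (f w) y"
  shows "ps_bounded r (M * N) (\<lambda>w. B (f w) (g w))"
proof -
  obtain b s where b: "((\<lambda>k. norm (b k) * r ^ k) has_sum s) UNIV" "s \<le> N"
    "\<And>w. w \<in> cball 0 r \<Longrightarrow> ((\<lambda>k. w ^ k *\<^sub>C b k) has_sum g w) UNIV"
    using ps_boundedE[OF g] by metis
  have "ps_bounded r (M * s) (\<lambda>w. B (f w) (g w))"
  proof (rule ps_bounded_has_sum)
    show "((\<lambda>k. M * (norm (b k) * r ^ k)) has_sum (M * s)) UNIV"
      by (intro has_sum_cmult_right b)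
    fix m
    have "ps_bounded r (r ^ m * (norm (b m) * M)) (\<lambda>w. w ^ m *\<^sub>C B (f w) (b m))"
      using assms(1) K
      by (intro ps_bounded_shift ps_bounded_linear[OF f] lin1
          bounded_bilinear.bounded_linear_left[OF B]) (simp_all add: mult.commute)
    then show "ps_bounded r (M * (norm (b m) * r ^ m)) (\<lambda>w. w ^ m *\<^sub>C B (f w) (b m))"
      by (simp add: mult_ac)
    show "((\<lambda>m. w ^ m *\<^sub>C B (f w) (b m)) has_sum B (f w) (g w)) UNIV" if "w \<in> cball 0 r" for w
      using has_sum_bounded_linear[OF bounded_bilinear.bounded_linear_right[OF B, of "f w"] b(3)[OF that]]
      by (simp add: lin2[OF that])
  qed (use assms(1) in simp)
  then show ?thesis
    using b(2) ps_bounded_nonneg[OF f] assms(1) by (elim ps_bounded_mono) (simp add: mult_left_mono)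
qed

lemma ps_bounded_mult:
  fixes f g :: "complex \<Rightarrow> 'a::complex_banach_algebra_1"
  assumes "0 < r" and "ps_bounded r M f" and "ps_bounded r N g"
  shows "ps_bounded r (M * N) (\<lambda>w. f w * g w)"
  by (rule ps_bounded_bilinear[OF assms bounded_bilinear_mult])
    (simp_all add: norm_mult_ineq mult_scaleC_left mult_scaleC_right)

lemma ps_bounded_power:
  fixes f :: "complex \<Rightarrow> 'a::complex_banach_algebra_1"
  assumes "0 < r" and "ps_bounded r M f"
  shows "ps_bounded r (M ^ n) (\<lambda>w. f w ^ n)"
  using assms
proof (induction n)
  case 0
  then show ?case using ps_bounded_const[of r "1::'a"] by simp
next
  case (Suc n)
  then show ?case by (simp add: ps_bounded_mult)
qed

section \<open>Re-expansion about other points, and the passage to and from analytic maps\<close>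

lemma ps_bounded_translate:
  assumes "ps_bounded r M f" and "0 < \<rho>" and "cmod z + \<rho> \<le> r"
  shows "ps_bounded \<rho> M (\<lambda>h. f (z + h))"
proof -
  obtain a s where a: "((\<lambda>k. norm (a k) * r ^ k) has_sum s) UNIV" "s \<le> M"
    "\<And>w. w \<in> cball 0 r \<Longrightarrow> ((\<lambda>k. w ^ k *\<^sub>C a k) has_sum f w) UNIV"
    using ps_boundedE[OF assms(1)] by metis
  have "ps_bounded \<rho> s (\<lambda>h. f (z + h))"
  \<comment> \<open>The series of \<open>f\<close> is read as a series of functions of
    \<open>h\<close>: the polynomial \<open>(z + h) ^ m\<close> has weighted norm at most
    \<open>(cmod z + \<rho>) ^ m\<close>, hence at most \<open>r ^ m\<close>, so the original
    majorant still works.\<close>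
  proof (rule ps_bounded_has_sum[OF assms(2) _ a(1)])
    fix m
    have 1: "ps_bounded \<rho> (cmod z + \<rho>) (\<lambda>h. z + h)"
      using ps_bounded_add[OF ps_bounded_const[of \<rho> z] ps_bounded_monom[of \<rho> "1::complex" 1]] assms(2)
      by (simp add: scaleC_complex_def)
    have "ps_bounded \<rho> (r ^ m) (\<lambda>h. (z + h) ^ m)"
      by (rule ps_bounded_mono[OF ps_bounded_power[OF assms(2) 1]])
        (use assms(2,3) in \<open>auto intro!: power_mono\<close>)
    from ps_bounded_linear[OF this bounded_linear_scaleC_left[of "a m"], of "norm (a m)"] assms(2)
    show "ps_bounded \<rho> (norm (a m) * r ^ m) (\<lambda>h. (z + h) ^ m *\<^sub>C a m)"
      by (simp add: norm_scaleC scaleC_complex_def scaleC_scaleC mult.commute)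
    fix h assume "h \<in> cball (0::complex) \<rho>"
    then have "z + h \<in> cball 0 r"
      using assms(3) norm_triangle_ineq[of z h] by simp
    then show "((\<lambda>m. (z + h) ^ m *\<^sub>C a m) has_sum f (z + h)) UNIV"
      by (rule a(3))
  qed
  then show ?thesis using a(2) by (rule ps_bounded_mono)
qed

text \<open>Analyticity asks for an expansion about every point of the open disc; translation
  supplies one about \<open>z\<close> with radius \<open>r - cmod z\<close>.\<close>

lemma ps_bounded_imp_analytic:
  assumes "ps_bounded r M f"
  shows "analytic_map_on f (ball 0 r)"
  unfolding analytic_map_on_def
proof
  fix z :: complex assume z: "z \<in> ball 0 r"
  define \<rho> where "\<rho> = r - cmod z"
  have "0 < \<rho>" using z by (simp add: \<rho>_def)
  have "ps_bounded \<rho> M (\<lambda>h. f (z + h))"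
    using assms \<open>0 < \<rho>\<close> by (rule ps_bounded_translate) (simp add: \<rho>_def)
  then obtain a where a: "\<forall>h\<in>cball 0 \<rho>. ((\<lambda>k. h ^ k *\<^sub>C a k) has_sum f (z + h)) UNIV"
    unfolding ps_bounded_def by (elim exE conjE) (rule that)
  have "(\<lambda>k. (w - z) ^ k *\<^sub>C a k) sums f w" if "w \<in> ball z \<rho>" for w
    using has_sum_imp_sums[OF a[rule_format, of "w - z"]] that by (simp add: dist_norm norm_minus_commute)
  then show "\<exists>r>0. \<exists>a. \<forall>w\<in>ball z r. (\<lambda>k. (w - z) ^ k *\<^sub>C a k) sums f w"
    using \<open>0 < \<rho>\<close> by (intro exI[of _ \<rho>] exI[of _ a] conjI ballI)
qed

text \<open>The terms of the series at \<open>2 * r\<close> tend to zero and so are bounded, which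
  makes the terms at radius \<open>r\<close> decay like powers of 1/2. Taking
  \<open>r = R / 4\<close> keeps \<open>2 * r\<close> strictly inside the open disc of
  convergence.\<close>

lemma analytic_imp_ps_bounded:
  fixes f :: "complex \<Rightarrow> 'a::complex_banach"
  assumes "analytic_map_on f U" and "0 \<in> U"
  obtains r M where "0 < r" "ps_bounded r M f"
proof -
  obtain R a where R: "R > 0" and a: "\<And>w. w \<in> ball 0 R \<Longrightarrow> (\<lambda>k. w ^ k *\<^sub>C a k) sums f w"
    using assms unfolding analytic_map_on_def by fastforce
  define r where "r = R / 4"
  have r: "0 < r" "2 * r < R" using R by (auto simp: r_def)
  have "(\<lambda>k. complex_of_real (2 * r) ^ k *\<^sub>C a k) sums f (complex_of_real (2 * r))"
    using r by (intro a) simp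
  then have "(\<lambda>k. complex_of_real (2 * r) ^ k *\<^sub>C a k) \<longlonglongrightarrow> 0"
    by (intro summable_LIMSEQ_zero) (rule sums_summable)
  then have "Bseq (\<lambda>k. complex_of_real (2 * r) ^ k *\<^sub>C a k)"
    using convergent_imp_Bseq convergentI by blast
  then obtain C where C: "\<And>k. norm (complex_of_real (2 * r) ^ k *\<^sub>C a k) \<le> C"
    by (auto simp: Bseq_def)
  have le: "norm (a k) * r ^ k \<le> C * (1/2) ^ k" for k
    using C[of k] r(1) by (simp add: norm_scaleC norm_mult norm_power power_mult_distrib field_simps)
  have "summable (\<lambda>k. norm (a k) * r ^ k)"
    by (rule summable_comparison_test'[where g = "\<lambda>k. C * (1/2) ^ k"])
      (use le r(1) in \<open>auto intro!: summable_mult summable_geometric\<close>)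
  then have n: "(\<lambda>k. norm (a k) * r ^ k) summable_on UNIV"
    using r(1) by (intro norm_summable_imp_summable_on) simp
  then obtain M where M: "((\<lambda>k. norm (a k) * r ^ k) has_sum M) UNIV"
    by (auto simp: summable_on_def)
  have f: "((\<lambda>k. w ^ k *\<^sub>C a k) has_sum f w) UNIV" if w: "w \<in> cball 0 r" for w
  proof -
    have "(\<lambda>k. w ^ k *\<^sub>C a k) summable_on UNIV"
      by (rule abs_summable_summable, rule Infinite_Sum.abs_summable_on_comparison_test'[OF n])
        (rule norm_powser_term_le[OF w])
    then obtain x where "((\<lambda>k. w ^ k *\<^sub>C a k) has_sum x) UNIV"
      by (auto simp: summable_on_def)
    moreover have "(\<lambda>k. w ^ k *\<^sub>C a k) sums f w"
      using w r by (intro a) simp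
    ultimately show ?thesis
      using has_sum_imp_sums sums_unique2 by metis
  qed
  show thesis
    by (rule that[OF r(1) ps_boundedI[OF M order.refl f]])
qed

subsection \<open>Lifting analytic maps through a family of operators\<close>

text \<open>The Baire half of the open mapping theorem: the closures of the images of the balls of
  integer radius cover the target, so one of them contains a ball. Approximate preimages suffice,
  since the iteration that removes the error is carried out later for whole power series.\<close>

lemma surj_approx_right_inverse:
  fixes T :: "'a::banach \<Rightarrow>\<^sub>L 'b::banach"
  assumes "surj (blinfun_apply T)"
  obtains C where "0 \<le> C" and "\<And>y. \<exists>x. norm x \<le> C * norm y \<and> norm (y - T x) \<le> norm y / 2"
proof -
  let ?F = "\<lambda>n::nat. closure (T ` cball 0 (real n))"
  have "(\<Union>n. ?F n) = UNIV"
  proof -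
    have "y \<in> (\<Union>n. ?F n)" for y
    proof -
      obtain x where "T x = y" using surjD[OF assms, of y] by auto
      moreover obtain n where "norm x \<le> real n" using real_arch_simple by blast
      ultimately have "y \<in> T ` cball 0 (real n)" by auto
      then have "y \<in> ?F n" using closure_subset by (rule rev_subsetD)
      then show ?thesis by (rule UN_I[OF UNIV_I])
    qed
    then show ?thesis by blast
  qed
  then have cover: "interior (\<Union>n. ?F n) \<noteq> {}" by simp
  have "\<exists>n. interior (?F n) \<noteq> {}"
  proof (rule ccontr)
    assume none: "\<not> (\<exists>n. interior (?F n) \<noteq> {})"
    have "euclidean interior_of (\<Union>n. ?F n) = {}"
    proof (rule Baire_category_alt)
      fix S assume "S \<in> range ?F"
      then obtain n where "S = ?F n" by (rule rangeE)
      then show "closedin euclidean S \<and> euclidean interior_of S = {}"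
        using none by simp
    qed (simp_all add: completely_metrizable_space_euclidean)
    with cover show False by simp
  qed
  then obtain n y0 where "y0 \<in> interior (?F n)" by blast
  then obtain d where d: "0 < d" "cball y0 d \<subseteq> ?F n"
    by (meson mem_interior_cball)
  have near: "\<exists>x. norm x \<le> real n \<and> norm (y - T x) < d / 4" if "norm (y - y0) \<le> d" for y
  proof -
    have "y \<in> ?F n" using that d(2) by (auto simp: dist_norm norm_minus_commute)
    then obtain v where "v \<in> T ` cball 0 (real n)" "dist v y < d / 4"
      using d(1) unfolding closure_approachable by (meson divide_pos_pos zero_less_numeral)
    then show ?thesis by (auto simp: dist_norm norm_minus_commute)
  qed
  show thesis
  proof
    show "0 \<le> 2 * real n / d" using d(1) by simp
    fix y :: 'b
    show "\<exists>x. norm x \<le> 2 * real n / d * norm y \<and> norm (y - T x) \<le> norm y / 2"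
    proof (cases "y = 0")
      case True
      then show ?thesis by (intro exI[of _ 0]) simp
    next
      case False
      \<comment> \<open>With this scale \<open>y0 + inverse c *\<^sub>R y\<close> lies at distance
        exactly \<open>d\<close> from \<open>y0\<close>. The two errors \<open>d / 4\<close> add up
        to \<open>d / 2\<close>, and rescaling by \<open>c\<close> turns this into
        \<open>norm y / 2\<close>.\<close>
      define c where "c = norm y / d"
      have c: "0 < c" using False d(1) by (simp add: c_def)
      obtain x1 where x1: "norm x1 \<le> real n" "norm ((y0 + inverse c *\<^sub>R y) - T x1) < d / 4"
        using near[of "y0 + inverse c *\<^sub>R y"] False d(1) by (auto simp: c_def)
      obtain x2 where x2: "norm x2 \<le> real n" "norm (y0 - T x2) < d / 4"
        using near[of y0] d(1) by auto
      let ?x = "c *\<^sub>R (x1 - x2)"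
      have "norm (x1 - x2) \<le> 2 * real n"
        using norm_triangle_ineq4[of x1 x2] x1(1) x2(1) by simp
      then have "c * norm (x1 - x2) \<le> c * (2 * real n)"
        using c by (intro mult_left_mono) simp_all
      moreover have "y - T ?x = c *\<^sub>R (((y0 + inverse c *\<^sub>R y) - T x1) - (y0 - T x2))"
        using c by (simp add: blinfun.scaleR_right blinfun.diff_right algebra_simps)
      then have "norm (y - T ?x) = c * norm (((y0 + inverse c *\<^sub>R y) - T x1) - (y0 - T x2))"
        using c by simp
      moreover have "\<dots> \<le> c * (d / 2)"
        using c x1(2) x2(2) norm_triangle_ineq4[of "(y0 + inverse c *\<^sub>R y) - T x1" "y0 - T x2"]
        by (intro mult_left_mono) simp_all
      ultimately show ?thesis
        using c d(1) by (intro exI[of _ ?x]) (simp add: c_def mult_ac)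
    qed
  qed
qed

lemma ps_bounded_of_coeffs:
  fixes a :: "nat \<Rightarrow> 'a::complex_banach"
  assumes "(g has_sum s) UNIV" and "\<And>k. norm (a k) * r ^ k \<le> g k" and "0 \<le> r"
  obtains f where "ps_bounded r s f"
    and "\<And>w. w \<in> cball 0 r \<Longrightarrow> ((\<lambda>k. w ^ k *\<^sub>C a k) has_sum f w) UNIV"
proof -
  have n: "(\<lambda>k. norm (a k) * r ^ k) summable_on UNIV"
    using has_sum_imp_summable[OF assms(1)] assms(2)
    by (rule summable_on_comparison_test) (use assms(3) in simp)
  have f: "((\<lambda>k. w ^ k *\<^sub>C a k) has_sum infsum (\<lambda>k. w ^ k *\<^sub>C a k) UNIV) UNIV"
    if "w \<in> cball 0 r" for w
    by (rule has_sum_infsum, rule abs_summable_summable,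
        rule Infinite_Sum.abs_summable_on_comparison_test'[OF n])
      (rule norm_powser_term_le[OF that])
  show thesis
    by (rule that[OF ps_bounded_comparison[OF assms f] f])
qed

lemma ps_bounded_blinfun_apply:
  fixes \<pi> :: "complex \<Rightarrow> 'a::complex_banach \<Rightarrow>\<^sub>L 'b::complex_banach"
  assumes "0 < r" and "ps_bounded r M \<pi>" and "ps_bounded r N f"
    and "\<And>c w x. w \<in> cball 0 r \<Longrightarrow> \<pi> w (c *\<^sub>C x) = c *\<^sub>C \<pi> w x"
  shows "ps_bounded r (M * N) (\<lambda>w. \<pi> w (f w))"
  by (rule ps_bounded_bilinear[OF assms(1-3) bounded_bilinear_blinfun_apply])
    (simp_all add: norm_blinfun scaleC_blinfun.rep_eq assms(4))

text \<open>Each coefficient of \<open>q\<close> is approximately lifted through the fixed operator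
  \<open>\<pi> 0\<close>, leaving half of the norm. Replacing \<open>\<pi> 0\<close> by
  \<open>\<pi> w\<close> adds an error of at most \<open>C * e\<close>, that is, another
  quarter.\<close>

lemma lift_approx:
  fixes \<pi> :: "complex \<Rightarrow> 'a::complex_banach \<Rightarrow>\<^sub>L 'b::complex_banach"
  assumes "0 < r" and "ps_bounded r e (\<lambda>w. \<pi> w - \<pi> 0)" and "C * e \<le> 1 / 4"
    and lin: "\<And>c w x. w \<in> cball 0 r \<Longrightarrow> \<pi> w (c *\<^sub>C x) = c *\<^sub>C \<pi> w x"
    and C: "0 \<le> C" "\<And>y. \<exists>x. norm x \<le> C * norm y \<and> norm (y - \<pi> 0 x) \<le> norm y / 2"
    and q: "ps_bounded r M q"
  shows "\<exists>u. ps_bounded r (C * M) u \<and> ps_bounded r (3 / 4 * M) (\<lambda>w. q w - \<pi> w (u w))"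
proof -
  obtain b s where b: "((\<lambda>k. norm (b k) * r ^ k) has_sum s) UNIV" "s \<le> M"
    "\<And>w. w \<in> cball 0 r \<Longrightarrow> ((\<lambda>k. w ^ k *\<^sub>C b k) has_sum q w) UNIV"
    using ps_boundedE[OF q] by metis
  have "\<forall>k. \<exists>x. norm x \<le> C * norm (b k) \<and> norm (b k - \<pi> 0 x) \<le> norm (b k) / 2"
    using C(2) by simp
  then obtain x where x: "\<And>k. norm (x k) \<le> C * norm (b k)"
    "\<And>k. norm (b k - \<pi> 0 (x k)) \<le> norm (b k) / 2"
    by metis
  have sC: "((\<lambda>k. C * (norm (b k) * r ^ k)) has_sum (C * s)) UNIV"
    by (rule has_sum_cmult_right[OF b(1)])
  have nx: "norm (x k) * r ^ k \<le> C * (norm (b k) * r ^ k)" for k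
    using mult_right_mono[OF x(1)[of k], of "r ^ k"] assms(1) by (simp add: mult.assoc)
  obtain u where u: "ps_bounded r (C * s) u"
    "\<And>w. w \<in> cball 0 r \<Longrightarrow> ((\<lambda>k. w ^ k *\<^sub>C x k) has_sum u w) UNIV"
    using ps_bounded_of_coeffs[of _ _ x r, OF sC nx] assms(1) by auto
  have s2: "((\<lambda>k. 1 / 2 * (norm (b k) * r ^ k)) has_sum (1 / 2 * s)) UNIV"
    by (rule has_sum_cmult_right[OF b(1)])
  have nd: "norm (b k - \<pi> 0 (x k)) * r ^ k \<le> 1 / 2 * (norm (b k) * r ^ k)" for k
    using mult_right_mono[OF x(2)[of k], of "r ^ k"] assms(1) by simp
  obtain d where d: "ps_bounded r (1 / 2 * s) d"
    "\<And>w. w \<in> cball 0 r \<Longrightarrow> ((\<lambda>k. w ^ k *\<^sub>C (b k - \<pi> 0 (x k))) has_sum d w) UNIV"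
    using ps_bounded_of_coeffs[of _ _ "\<lambda>k. b k - \<pi> 0 (x k)" r, OF s2 nd] assms(1) by auto
  have d_eq: "d w = q w - \<pi> 0 (u w)" if w: "w \<in> cball 0 r" for w
  proof -
    have "((\<lambda>k. \<pi> 0 (w ^ k *\<^sub>C x k)) has_sum \<pi> 0 (u w)) UNIV"
      by (rule has_sum_bounded_linear[OF blinfun.bounded_linear_right u(2)[OF w]])
    then have "((\<lambda>k. w ^ k *\<^sub>C \<pi> 0 (x k)) has_sum \<pi> 0 (u w)) UNIV"
      using assms(1) by (simp add: lin)
    then have "((\<lambda>k. - (w ^ k *\<^sub>C \<pi> 0 (x k))) has_sum - \<pi> 0 (u w)) UNIV"
      by (simp only: has_sum_uminus minus_minus)
    from has_sum_add[OF b(3)[OF w] this]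
    have "((\<lambda>k. w ^ k *\<^sub>C (b k - \<pi> 0 (x k))) has_sum (q w - \<pi> 0 (u w))) UNIV"
      by (simp add: scaleC_diff_right)
    with d(2)[OF w] show ?thesis by (rule has_sum_unique)
  qed
  have "ps_bounded r (e * (C * s)) (\<lambda>w. (\<pi> w - \<pi> 0) (u w))"
    by (rule ps_bounded_blinfun_apply[OF assms(1,2) u(1)])
      (use assms(1) in \<open>simp add: blinfun.diff_left lin scaleC_diff_right\<close>)
  with d(1) have "ps_bounded r (1 / 2 * s + e * (C * s)) (\<lambda>w. d w - (\<pi> w - \<pi> 0) (u w))"
    using assms(1) by (intro ps_bounded_diff) simp_all
  moreover have "0 \<le> s"
    using b(1) assms(1) by (intro has_sum_nonneg[OF b(1)]) simp
  then have "(C * e) * s \<le> 1 / 4 * s"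
    by (rule mult_right_mono[OF assms(3)])
  then have "1 / 2 * s + e * (C * s) \<le> 3 / 4 * M"
    using b(2) by (simp add: mult_ac)
  ultimately have "ps_bounded r (3 / 4 * M) (\<lambda>w. d w - (\<pi> w - \<pi> 0) (u w))"
    by (rule ps_bounded_mono)
  then have "ps_bounded r (3 / 4 * M) (\<lambda>w. q w - \<pi> w (u w))"
    by (rule ps_bounded_cong) (simp add: d_eq blinfun.diff_left)
  moreover have "ps_bounded r (C * M) u"
    by (rule ps_bounded_mono[OF u(1)]) (simp add: b(2) C(1) mult_left_mono)
  ultimately show ?thesis by (intro exI[of _ u] conjI)
qed

text \<open>The approximate lift is applied repeatedly to the residual. Residuals shrink by 3/4 at
  each step, so the corrections have bounds \<open>C * M * (3 / 4) ^ n\<close>, whose sum is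
  \<open>4 * C * M\<close>.\<close>

lemma lift_exact:
  fixes \<pi> :: "complex \<Rightarrow> 'a::complex_banach \<Rightarrow>\<^sub>L 'b::complex_banach"
  assumes "0 < r" and "ps_bounded r e (\<lambda>w. \<pi> w - \<pi> 0)" and "C * e \<le> 1 / 4"
    and lin: "\<And>c w x. w \<in> cball 0 r \<Longrightarrow> \<pi> w (c *\<^sub>C x) = c *\<^sub>C \<pi> w x"
    and C: "0 \<le> C" "\<And>y. \<exists>x. norm x \<le> C * norm y \<and> norm (y - \<pi> 0 x) \<le> norm y / 2"
    and q: "ps_bounded r M q"
  shows "\<exists>f. ps_bounded r (4 * C * M) f \<and> (\<forall>w\<in>cball 0 r. \<pi> w (f w) = q w)"
proof -
  \<comment> \<open>The correction is chosen as a function \<open>U\<close> of the residual and of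
    its bound, so that the recursion can be written down.\<close>
  have "\<forall>N g. \<exists>u. ps_bounded r N g \<longrightarrow>
    ps_bounded r (C * N) u \<and> ps_bounded r (3 / 4 * N) (\<lambda>w. g w - \<pi> w (u w))"
    using lift_approx[OF assms(1-3) lin C] by auto
  then obtain U where U: "\<And>N g. ps_bounded r N g \<Longrightarrow> ps_bounded r (C * N) (U N g)"
    "\<And>N g. ps_bounded r N g \<Longrightarrow> ps_bounded r (3 / 4 * N) (\<lambda>w. g w - \<pi> w (U N g w))"
    unfolding choice_iff by auto
  \<comment> \<open>\<open>Q n\<close> is what remains of \<open>q\<close> after \<open>n\<close>
    corrections, and \<open>u n\<close> is the next correction.\<close>
  define Q where "Q = rec_nat q (\<lambda>n g w. g w - \<pi> w (U (M * (3 / 4) ^ n) g w))"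
  define u where "u n = U (M * (3 / 4) ^ n) (Q n)" for n
  have Q_Suc: "Q (Suc n) = (\<lambda>w. Q n w - \<pi> w (u n w))" for n
    by (simp add: Q_def u_def)
  have Q: "ps_bounded r (M * (3 / 4) ^ n) (Q n)" for n
  proof (induction n)
    case 0
    then show ?case by (simp add: Q_def q)
  next
    case (Suc n)
    from U(2)[OF this] show ?case by (simp add: Q_Suc u_def mult_ac)
  qed
  have u: "ps_bounded r (C * M * (3 / 4) ^ n) (u n)" for n
    using U(1)[OF Q[of n]] by (simp add: u_def mult.assoc)
  have "((\<lambda>n. (3 / 4) ^ n :: real) has_sum 4) UNIV"
    using geometric_sums[of "3 / 4 :: real"] by (intro norm_summable_imp_has_sum) simp_all
  from has_sum_cmult_right[OF this]
  have geo: "((\<lambda>n. C * M * (3 / 4) ^ n) has_sum (C * M * 4)) UNIV" by blast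
  define f where "f w = infsum (\<lambda>n. u n w) UNIV" for w
  have f: "((\<lambda>n. u n w) has_sum f w) UNIV" if "w \<in> cball 0 r" for w
    unfolding f_def
    by (rule has_sum_infsum, rule abs_summable_summable,
        rule Infinite_Sum.abs_summable_on_comparison_test'[OF has_sum_imp_summable[OF geo]])
      (rule ps_bounded_norm_le[OF u that])
  have "ps_bounded r (C * M * 4) f"
    by (rule ps_bounded_has_sum[OF assms(1) u geo f])
  moreover have "\<pi> w (f w) = q w" if w: "w \<in> cball 0 r" for w
  proof -
    have "(\<lambda>n. \<pi> w (u n w)) sums \<pi> w (f w)"
      by (rule has_sum_imp_sums[OF has_sum_bounded_linear[OF blinfun.bounded_linear_right f[OF w]]])
    moreover have "(\<lambda>n. Q n w) \<longlonglongrightarrow> 0"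
    proof (rule Lim_null_comparison)
      show "\<forall>\<^sub>F n in sequentially. norm (Q n w) \<le> M * (3 / 4) ^ n"
        using ps_bounded_norm_le[OF Q w] by simp
      show "(\<lambda>n. M * (3 / 4) ^ n) \<longlonglongrightarrow> 0"
        by (intro tendsto_mult_right_zero LIMSEQ_power_zero) simp
    qed
    \<comment> \<open>The image of each correction is a difference of consecutive residuals, so the
      series telescopes to \<open>q w\<close>.\<close>
    then have "(\<lambda>n. Q n w - Q (Suc n) w) sums (Q 0 w - 0)"
      by (rule telescope_sums')
    then have "(\<lambda>n. \<pi> w (u n w)) sums q w"
      by (simp add: Q_Suc Q_def[THEN fun_cong, of 0])
    ultimately show ?thesis by (rule sums_unique2)
  qed
  ultimately show ?thesis by (intro exI[of _ f]) (simp add: mult_ac)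
qed

lemma lift_analytic:
  fixes \<pi> :: "complex \<Rightarrow> 'a::complex_banach \<Rightarrow>\<^sub>L 'b::complex_banach"
  assumes "0 < R" and \<pi>: "ps_bounded R L \<pi>" and "surj (blinfun_apply (\<pi> 0))"
    and lin: "\<And>c w x. w \<in> cball 0 R \<Longrightarrow> \<pi> w (c *\<^sub>C x) = c *\<^sub>C \<pi> w x"
    and q: "ps_bounded R M q"
  obtains r N f where "0 < r" and "r \<le> R" and "ps_bounded r N f"
    and "\<And>w. w \<in> cball 0 r \<Longrightarrow> \<pi> w (f w) = q w"
proof -
  obtain C where C: "0 \<le> C" "\<And>y. \<exists>x. norm x \<le> C * norm y \<and> norm (y - \<pi> 0 x) \<le> norm y / 2"
    using surj_approx_right_inverse[OF assms(3)] by metis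
  have d: "ps_bounded R (L + norm (\<pi> 0)) (\<lambda>w. \<pi> w - \<pi> 0)"
    using ps_bounded_diff[OF \<pi> ps_bounded_const] assms(1) by simp
  have L: "0 \<le> L + norm (\<pi> 0)"
    using ps_bounded_nonneg[OF d] assms(1) by simp
  \<comment> \<open>\<open>\<pi> w - \<pi> 0\<close> vanishes at \<open>0\<close>, so shrinking by
    \<open>t\<close> scales its bound by \<open>t\<close>. This \<open>t\<close> brings
    \<open>C\<close> times the new bound to at most 1/4, and the summand 1 in the denominator
    ensures that \<open>t\<close> is defined and at most 1.\<close>
  define t where "t = 1 / (1 + 4 * (C * (L + norm (\<pi> 0))))"
  have pos: "0 \<le> C * (L + norm (\<pi> 0))"
    using C(1) L by (intro mult_nonneg_nonneg) simp_all
  have t: "0 < t" "t \<le> 1" "C * (t * (L + norm (\<pi> 0))) \<le> 1 / 4"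
    using pos by (simp_all add: t_def divide_simps)
  have r: "0 < t * R" "t * R \<le> R"
    using t assms(1) by (simp_all add: mult_left_le_one_le)
  have "ps_bounded (t * R) (t * (L + norm (\<pi> 0))) (\<lambda>w. \<pi> w - \<pi> 0)"
    using ps_bounded_shrink[OF d, of t] t assms(1) by simp
  moreover have "ps_bounded (t * R) M q"
    using ps_bounded_radius_mono[OF q, of "t * R"] r by simp
  moreover have "\<pi> w (c *\<^sub>C x) = c *\<^sub>C \<pi> w x" if "w \<in> cball 0 (t * R)" for c w x
    using that r(2) by (intro lin) simp
  ultimately obtain f where f: "ps_bounded (t * R) (4 * C * M) f"
    "\<forall>w\<in>cball 0 (t * R). \<pi> w (f w) = q w"
    using lift_exact[of "t * R" "t * (L + norm (\<pi> 0))" \<pi> C M q] r(1) t(3) C by auto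
  show thesis
    by (rule that[OF r f(1)]) (rule f(2)[rule_format])
qed

subsection \<open>Powers of quasinilpotent elements\<close>

text \<open>Division with remainder \<open>m = N * a + b\<close> bounds the \<open>m\<close>-th
  power by \<open>a\<close> small factors and fewer than \<open>N\<close> large ones. The predicate
  \<open>P\<close> is abstract because the bound is used both for norms of powers of one element and
  for weighted norms of powers of a power series.\<close>

lemma geometric_bound_of_power_bound:
  fixes P :: "nat \<Rightarrow> real \<Rightarrow> bool"
  assumes mult: "\<And>m n c d. P m c \<Longrightarrow> P n d \<Longrightarrow> P (m + n) (c * d)"
    and mono: "\<And>m c d. P m c \<Longrightarrow> c \<le> d \<Longrightarrow> P m d"
    and zero: "P 0 1" and one: "P 1 c1"
    and N: "P N \<theta>" "0 < N" "\<theta> < 1"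
  obtains C \<rho> where "0 < \<rho>" "\<rho> < 1" "\<And>m. P m (C * \<rho> ^ m)"
proof -
  define K where "K = max 1 c1"
  have K: "1 \<le> K" "P 1 K"
    using mono[OF one, of K] by (simp_all add: K_def)
  have P_small: "P b (K ^ b)" for b
  proof (induction b)
    case (Suc b)
    from mult[OF K(2) this] show ?case by simp
  qed (simp add: zero)
  \<comment> \<open>The maximum with 1/2 makes the ratio positive, so that its \<open>N\<close>-th
    root is positive and division by it is legitimate.\<close>
  define \<tau> where "\<tau> = max \<theta> (1/2)"
  have \<tau>: "0 < \<tau>" "\<tau> < 1" "P N \<tau>"
    using N(3) mono[OF N(1), of \<tau>] by (simp_all add: \<tau>_def)
  have P_N: "P (N * a) (\<tau> ^ a)" for a
  proof (induction a)
    case (Suc a)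
    from mult[OF \<tau>(3) this] show ?case by simp
  qed (simp add: zero)
  define \<rho> where "\<rho> = root N \<tau>"
  have \<rho>: "0 < \<rho>" "\<rho> < 1" "\<rho> ^ N = \<tau>"
    using \<tau> N(2) by (simp_all add: \<rho>_def real_root_gt_zero)
  have "P m (K ^ N / \<tau> * \<rho> ^ m)" for m
  proof -
    define a b where "a = m div N" and "b = m mod N"
    have m: "m = N * a + b" and b: "b \<le> N"
      using N(2) by (simp_all add: a_def b_def less_imp_le)
    have "P m (\<tau> ^ a * K ^ b)"
      unfolding m by (rule mult[OF P_N P_small])
    moreover have "\<tau> ^ a * K ^ b \<le> K ^ N / \<tau> * \<rho> ^ m"
    proof -
      \<comment> \<open>As \<open>b\<close> is at most \<open>N\<close>, the remainder costs only
        the constant factor \<open>K ^ N / \<tau>\<close>.\<close>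
      have "\<tau> \<le> \<rho> ^ b"
        using power_decreasing[OF b, of \<rho>] \<rho> by simp
      moreover have "K ^ b \<le> K ^ N"
        by (rule power_increasing[OF b K(1)])
      ultimately have "\<tau> * K ^ b \<le> \<rho> ^ b * K ^ N"
        using \<rho>(1) K(1) by (intro mult_mono) simp_all
      then have "K ^ b \<le> \<rho> ^ b * K ^ N / \<tau>"
        using \<tau>(1) by (simp add: field_simps)
      then have "\<tau> ^ a * K ^ b \<le> \<tau> ^ a * (\<rho> ^ b * K ^ N / \<tau>)"
        using \<tau>(1) by (intro mult_left_mono) simp_all
      also have "\<dots> = K ^ N / \<tau> * \<rho> ^ m"
        by (simp add: m power_add power_mult \<rho>(3))
      finally show ?thesis .
    qed
    ultimately show ?thesis by (rule mono)
  qed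
  then show thesis by (rule that[OF \<rho>(1,2)])
qed

lemma power_tendsto_zero:
  fixes y :: "'a::real_normed_algebra_1"
  assumes "norm (y ^ N) < 1" and "0 < N"
  shows "(\<lambda>m. y ^ m) \<longlonglongrightarrow> 0"
proof -
  obtain \<rho> C where \<rho>: "0 < \<rho>" "\<rho> < 1" and C: "\<And>m. norm (y ^ m) \<le> C * \<rho> ^ m"
  proof (rule geometric_bound_of_power_bound[of "\<lambda>m c. norm (y ^ m) \<le> c" "norm y" N "norm (y ^ N)"])
    fix m n and c d :: real assume "norm (y ^ m) \<le> c" "norm (y ^ n) \<le> d"
    then have "norm (y ^ m) * norm (y ^ n) \<le> c * d"
      by (intro mult_mono) (auto intro: order_trans[OF norm_ge_zero])
    then show "norm (y ^ (m + n)) \<le> c * d"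
      unfolding power_add by (rule order_trans[OF norm_mult_ineq])
  next
    fix C \<rho> assume "0 < \<rho>" "\<rho> < 1" "\<And>m. norm (y ^ m) \<le> C * \<rho> ^ m"
    then show thesis by (rule that)
  qed (use assms in simp_all)
  have "(\<lambda>m. C * \<rho> ^ m) \<longlonglongrightarrow> 0"
    using \<rho> by (intro tendsto_mult_right_zero LIMSEQ_power_zero) simp
  then show ?thesis
    by (rule Lim_null_comparison[rotated]) (simp add: C)
qed

text \<open>The resolvent identity writes \<open>F z - F w\<close> as
  \<open>(z - w) *\<^sub>C (F z * y * F w)\<close>. For \<open>z\<close> near \<open>w\<close>, half
  of \<open>norm (F z)\<close> can be absorbed, which bounds \<open>F z\<close> by twice
  \<open>norm (F w)\<close>.\<close>

lemma continuous_on_resolvent: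
  fixes y :: "'a::complex_banach_algebra_1"
  assumes F: "\<And>z. F z * (1 - z *\<^sub>C y) = 1" "\<And>z. (1 - z *\<^sub>C y) * F z = 1"
  shows "continuous_on UNIV F"
proof -
  have "isCont F w" for w
  proof -
    define K where "K = norm y * norm (F w)"
    have K: "0 \<le> K" by (simp add: K_def)
    have le: "norm (F z - F w) \<le> cmod (z - w) * norm (F z) * K" for z
    proof -
      have "F z - F w = F z * ((1 - w *\<^sub>C y) - (1 - z *\<^sub>C y)) * F w"
        using F(1)[of z] F(2)[of w]
        by (simp only: right_diff_distrib left_diff_distrib)
          (simp add: mult.assoc right_diff_distrib[symmetric])
      also have "\<dots> = (z - w) *\<^sub>C (F z * y * F w)"
        by (simp add: scaleC_diff_left mult_scaleC_left mult_scaleC_right algebra_simps)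
      also have "norm \<dots> \<le> cmod (z - w) * (norm (F z) * norm y * norm (F w))"
        unfolding norm_scaleC
        by (intro mult_left_mono order_trans[OF norm_mult_ineq] mult_right_mono norm_mult_ineq) simp_all
      finally show ?thesis by (simp add: K_def mult_ac)
    qed
    have bound: "norm (F z) \<le> 2 * norm (F w)" if "cmod (z - w) * K \<le> 1/2" for z
    proof -
      have "cmod (z - w) * norm (F z) * K \<le> 1/2 * norm (F z)"
        using mult_right_mono[OF that, of "norm (F z)"] by (simp add: mult_ac)
      moreover have "norm (F z) \<le> norm (F w) + norm (F z - F w)"
        using norm_triangle_sub by blast
      ultimately show ?thesis using le[of z] by simp
    qed
    have "((\<lambda>z. cmod (z - w) * K) \<longlongrightarrow> cmod (w - w) * K) (at w)"
      by (intro tendsto_intros)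
    then have "\<forall>\<^sub>F z in at w. cmod (z - w) * K < 1/2"
      by (rule order_tendstoD) simp
    then have ev: "\<forall>\<^sub>F z in at w. norm (F z - F w) \<le> cmod (z - w) * (2 * norm (F w)) * K"
    proof (rule eventually_mono)
      fix z assume "cmod (z - w) * K < 1/2"
      then have "cmod (z - w) * norm (F z) * K \<le> cmod (z - w) * (2 * norm (F w)) * K"
        using K by (intro mult_right_mono mult_left_mono bound) simp_all
      with le[of z] show "norm (F z - F w) \<le> cmod (z - w) * (2 * norm (F w)) * K" by simp
    qed
    have "((\<lambda>z. cmod (z - w) * (2 * norm (F w)) * K) \<longlongrightarrow> cmod (w - w) * (2 * norm (F w)) * K) (at w)"
      by (intro tendsto_intros)
    then have "((\<lambda>z. F z - F w) \<longlongrightarrow> 0) (at w)"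
      using ev by (intro Lim_null_comparison[OF ev]) simp
    then show ?thesis
      by (simp add: isCont_def LIM_zero_iff)
  qed
  then show ?thesis
    by (simp add: continuous_on_eq_continuous_at)
qed

text \<open>The inverse of \<open>1 - (zy)\<^sup>2\<close> is the average of the inverses of \<open>1 - zy\<close> and \<open>1 + zy\<close>. Iterating,
  the inverses of \<open>1 - (zy)\<^bsup>2^k\<^esup>\<close> are averages of values of the resolvent on a circle,
  so they inherit its modulus of continuity uniformly in \<open>k\<close>.\<close>

lemma resolvent_power_of_two:
  fixes y :: "'a::complex_banach_algebra_1"
  assumes F: "\<And>z. F z * (1 - z *\<^sub>C y) = 1" "\<And>z. (1 - z *\<^sub>C y) * F z = 1"
    and e: "\<And>z. cmod z = 1 \<Longrightarrow> norm (F (s * z) - F (t * z)) \<le> e"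
  shows "\<exists>G. (\<forall>z. G z * (1 - z ^ (2 ^ k) *\<^sub>C y ^ (2 ^ k)) = 1) \<and>
    (\<forall>z. (1 - z ^ (2 ^ k) *\<^sub>C y ^ (2 ^ k)) * G z = 1) \<and>
    (\<forall>z. cmod z = 1 \<longrightarrow> norm (G (s * z) - G (t * z)) \<le> e)"
proof (induction k)
  case 0
  show ?case using F e by (intro exI[of _ F]) simp
next
  case (Suc k)
  then obtain G where G: "\<And>z. G z * (1 - z ^ (2 ^ k) *\<^sub>C y ^ (2 ^ k)) = 1"
    "\<And>z. (1 - z ^ (2 ^ k) *\<^sub>C y ^ (2 ^ k)) * G z = 1"
    "\<And>z. cmod z = 1 \<Longrightarrow> norm (G (s * z) - G (t * z)) \<le> e"
    by auto
  \<comment> \<open>Multiplying \<open>z\<close> by this root of -1 keeps its modulus and changes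
    the sign of \<open>z ^ (2 ^ k)\<close>, so \<open>G (\<zeta> * z)\<close> inverts the other
    factor of the difference of squares.\<close>
  define \<zeta> where "\<zeta> = cis (pi / 2 ^ k)"
  have "\<zeta> ^ (2 ^ k) = cis (real (2 ^ k) * (pi / 2 ^ k))"
    unfolding \<zeta>_def by (rule Complex.DeMoivre)
  also have "real (2 ^ k) * (pi / 2 ^ k) = pi" by simp
  finally have \<zeta>: "\<zeta> ^ (2 ^ k) = -1" "cmod \<zeta> = 1"
    by (simp_all add: \<zeta>_def)
  define H where "H z = (1/2) *\<^sub>R (G z + G (\<zeta> * z))" for z
  have G': "G (\<zeta> * z) * (1 + z ^ (2 ^ k) *\<^sub>C y ^ (2 ^ k)) = 1"
    "(1 + z ^ (2 ^ k) *\<^sub>C y ^ (2 ^ k)) * G (\<zeta> * z) = 1" for z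
    using G(1,2)[of "\<zeta> * z"] by (simp_all add: power_mult_distrib \<zeta>(1) scaleC_minus_left)
  have sq: "1 - z ^ (2 ^ Suc k) *\<^sub>C y ^ (2 ^ Suc k) =
      (1 - z ^ (2 ^ k) *\<^sub>C y ^ (2 ^ k)) * (1 + z ^ (2 ^ k) *\<^sub>C y ^ (2 ^ k))" for z
    by (simp add: algebra_simps mult_scaleC_left mult_scaleC_right scaleC_scaleC power_mult scaleC_diff_right scaleC_add_right
        power2_eq_square mult_2 power_add)
  have sq': "1 - z ^ (2 ^ Suc k) *\<^sub>C y ^ (2 ^ Suc k) =
      (1 + z ^ (2 ^ k) *\<^sub>C y ^ (2 ^ k)) * (1 - z ^ (2 ^ k) *\<^sub>C y ^ (2 ^ k))" for z
    by (simp add: algebra_simps mult_scaleC_left mult_scaleC_right scaleC_scaleC power_mult scaleC_diff_right scaleC_add_right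
        power2_eq_square mult_2 power_add)
  show ?case
  proof (intro exI[of _ H] conjI allI impI)
    fix z
    let ?Y = "z ^ (2 ^ k) *\<^sub>C y ^ (2 ^ k)"
    let ?D = "1 - z ^ (2 ^ Suc k) *\<^sub>C y ^ (2 ^ Suc k)"
    have avg: "(1/2) *\<^sub>R ((1 + ?Y) + (1 - ?Y)) = 1"
      by (simp add: scaleR_2[symmetric])
    have "G z * ?D = (G z * (1 - ?Y)) * (1 + ?Y)" unfolding sq by (simp only: mult.assoc)
    moreover have "G (\<zeta> * z) * ?D = (G (\<zeta> * z) * (1 + ?Y)) * (1 - ?Y)"
      unfolding sq' by (simp only: mult.assoc)
    ultimately show "H z * ?D = 1"
      by (simp only: H_def mult_scaleR_left distrib_right[of "G z"] G(1) G'(1) mult_1_left avg)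
    have "?D * G z = (1 + ?Y) * ((1 - ?Y) * G z)" unfolding sq' by (simp only: mult.assoc)
    moreover have "?D * G (\<zeta> * z) = (1 - ?Y) * ((1 + ?Y) * G (\<zeta> * z))"
      unfolding sq by (simp only: mult.assoc)
    ultimately show "?D * H z = 1"
      by (simp only: H_def mult_scaleR_right distrib_left[of _ "G z"] G(2) G'(2) mult_1_right avg)
    assume z: "cmod z = 1"
    have "H (s * z) - H (t * z) =
      (1/2) *\<^sub>R ((G (s * z) - G (t * z)) + (G (s * (\<zeta> * z)) - G (t * (\<zeta> * z))))"
      by (simp add: H_def algebra_simps)
    also have "norm \<dots> \<le> (1/2) * (e + e)"
      using norm_triangle_mono[OF G(3)[OF z] G(3)[of "\<zeta> * z"]] z \<zeta>(2)
      by (simp add: norm_mult)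
    finally show "norm (H (s * z) - H (t * z)) \<le> e" by simp
  qed
qed

text \<open>From \<open>F - 1 = F * Y\<close> the distance \<open>d\<close> of \<open>F\<close> from
  1 satisfies \<open>d \<le> (1 + d) / 9\<close>, which is \<open>d \<le> 1/8\<close>.\<close>

lemma norm_inverse_minus_one_le:
  fixes Y :: "'a::real_normed_algebra_1"
  assumes "F * (1 - Y) = 1" and "norm Y \<le> 1/9"
  shows "norm (F - 1) \<le> 1/8"
proof -
  have "F - 1 = F * Y" using assms(1) by (simp add: algebra_simps)
  then have "norm (F - 1) \<le> norm F * norm Y" by (simp add: norm_mult_ineq)
  also have "\<dots> \<le> norm F * (1/9)" using assms(2) by (intro mult_left_mono) simp_all
  also have "norm F \<le> 1 + norm (F - 1)"
    using norm_triangle_ineq[of 1 "F - 1"] by simp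
  finally show ?thesis by simp
qed

text \<open>A converse: \<open>Y = (F - 1) * (1 - Y)\<close> yields
  \<open>norm Y \<le> (1 + norm Y) / 4\<close>, so the norm is at most 1/3.\<close>

lemma norm_less_one_if_inverse_near_one:
  fixes Y :: "'a::real_normed_algebra_1"
  assumes "F * (1 - Y) = 1" and "norm (F - 1) \<le> 1/4"
  shows "norm Y < 1"
proof -
  have "Y = (F - 1) * (1 - Y)" using assms(1) by (simp add: algebra_simps)
  then have "norm Y \<le> norm (F - 1) * norm (1 - Y)" by (metis norm_mult_ineq)
  also have "\<dots> \<le> 1/4 * (1 + norm Y)"
    using assms(2) norm_triangle_ineq4[of 1 Y] by (intro mult_mono) simp_all
  finally show ?thesis by simp
qed

text \<open>Rickart's continuation along radii: the set \<open>S\<close> contains 0, and uniform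
  continuity of \<open>F\<close> on the compact unit disc gives one step length
  \<open>\<delta>\<close> valid at every radius, so finitely many steps reach 1.\<close>

lemma norm_power_less_one_of_resolvent:
  fixes y :: "'a::complex_banach_algebra_1"
  assumes F: "\<And>z. F z * (1 - z *\<^sub>C y) = 1" "\<And>z. (1 - z *\<^sub>C y) * F z = 1"
  shows "\<exists>N>0. norm (y ^ N) < 1"
proof -
  define S where "S = {s::real. \<exists>N>0. norm ((complex_of_real s *\<^sub>C y) ^ N) < 1}"
  have "uniformly_continuous_on (cball 0 1) F"
    using continuous_on_subset[OF continuous_on_resolvent[of F y, OF F]]
    by (intro compact_uniformly_continuous) simp_all
  then obtain \<delta> where \<delta>: "\<delta> > 0"
    "\<And>z w. z \<in> cball 0 1 \<Longrightarrow> w \<in> cball 0 1 \<Longrightarrow> dist w z < \<delta> \<Longrightarrow> dist (F w) (F z) < 1/8"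
    unfolding uniformly_continuous_on_def by (metis zero_less_divide_1_iff zero_less_numeral)
  \<comment> \<open>At radius \<open>s\<close> a high dyadic power is so small that its inverse
    \<open>G s\<close> is within 1/8 of 1. Moving to \<open>t\<close> changes the inverse by at most
    another 1/8, whatever the exponent, and a total of 1/4 still forces the power at
    \<open>t\<close> to have norm below 1.\<close>
  have step: "t \<in> S" if s: "s \<in> S" "0 \<le> s" "s \<le> 1" and t: "0 \<le> t" "t \<le> 1" "\<bar>s - t\<bar> < \<delta>" for s t
  proof -
    have near: "norm (F (complex_of_real s * z) - F (complex_of_real t * z)) \<le> 1/8" if "cmod z = 1" for z
    proof -
      have "dist (of_real s * z) (of_real t * z) = \<bar>s - t\<bar>"
        unfolding dist_norm left_diff_distrib[symmetric] of_real_diff[symmetric] norm_mult norm_of_real that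
        by simp
      then show ?thesis
        using \<delta>(2)[of "of_real t * z" "of_real s * z"] s t that
        by (simp add: dist_norm norm_mult less_imp_le)
    qed
    obtain N where "N > 0" "norm ((complex_of_real s *\<^sub>C y) ^ N) < 1"
      using s(1) by (auto simp: S_def)
    then have "(\<lambda>m. (complex_of_real s *\<^sub>C y) ^ m) \<longlonglongrightarrow> 0"
      by (intro power_tendsto_zero)
    then have "\<forall>\<^sub>F m in sequentially. norm ((complex_of_real s *\<^sub>C y) ^ m) < 1/9"
      using order_tendstoD(2)[OF tendsto_norm_zero, of _ sequentially "1/9"] by simp
    then obtain k where k: "\<And>m. m \<ge> k \<Longrightarrow> norm ((complex_of_real s *\<^sub>C y) ^ m) < 1/9"
      by (auto simp: eventually_sequentially)
    obtain G where G: "\<And>z. G z * (1 - z ^ (2 ^ k) *\<^sub>C y ^ (2 ^ k)) = 1"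
      "\<And>z. cmod z = 1 \<Longrightarrow> norm (G (complex_of_real s * z) - G (complex_of_real t * z)) \<le> 1/8"
      using resolvent_power_of_two[of F y "of_real s" "of_real t" "1/8" k, OF F near] by auto
    \<comment> \<open>The exponent \<open>2 ^ k\<close> exceeds \<open>k\<close>, so the tail
      estimate covers it.\<close>
    have "norm (complex_of_real s ^ (2 ^ k) *\<^sub>C y ^ (2 ^ k)) \<le> 1/9"
      using k[of "2 ^ k"] less_exp[of k] by (simp add: power_scaleC)
    with G(1)[of s] have "norm (G s - 1) \<le> 1/8"
      by (rule norm_inverse_minus_one_le)
    moreover have "norm (G s - G t) \<le> 1/8"
      using G(2)[of 1] by simp
    moreover have "norm (G t - 1) \<le> norm (G s - 1) + norm (G s - G t)"
      using norm_triangle_ineq4[of "G s - 1" "G s - G t"] by simp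
    ultimately have "norm (G t - 1) \<le> 1/4" by simp
    with G(1)[of t] have "norm (complex_of_real t ^ (2 ^ k) *\<^sub>C y ^ (2 ^ k)) < 1"
      by (rule norm_less_one_if_inverse_near_one)
    then show ?thesis
      unfolding S_def by (intro CollectI exI[of _ "2 ^ k"]) (simp add: power_scaleC)
  qed
  \<comment> \<open>The interval from 0 to 1 is cut into \<open>J\<close> steps of length below
    \<open>\<delta>\<close>.\<close>
  obtain J where J: "1 / \<delta> < real J" using reals_Archimedean2 by blast
  have "0 < real J"
    using J divide_pos_pos[OF zero_less_one \<delta>(1)] by (rule less_trans[rotated])
  then have J0: "0 < J" "1 / real J < \<delta>"
    using \<delta>(1) J by (simp_all add: pos_divide_less_eq mult.commute)
  have "real j / real J \<in> S" if "j \<le> J" for j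
    using that
  proof (induction j)
    case 0
    show ?case by (auto simp: S_def intro!: exI[of _ 1])
  next
    case (Suc j)
    then have "real j / real J \<in> S" by simp
    then show ?case
      by (rule step) (use Suc.prems J0 in \<open>simp_all add: diff_divide_distrib[symmetric]\<close>)
  qed
  from this[of J] show ?thesis using J0(1) by (simp add: S_def)
qed

text \<open>For nonzero \<open>z\<close> the number \<open>inverse z\<close> lies outside the
  spectrum, so \<open>1 - z *\<^sub>C x\<close> is invertible for every \<open>z\<close> and the
  resolvent argument applies.\<close>

lemma quasinilpotent_power_small:
  fixes x :: "'a::complex_banach_algebra_1"
  assumes "algebra_spectrum x = {0}"
  shows "\<exists>N>0. norm ((c *\<^sub>C x) ^ N) < 1"
proof -
  have "\<exists>y. y * (1 - z *\<^sub>C x) = 1 \<and> (1 - z *\<^sub>C x) * y = 1" for z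
  proof (cases "z = 0")
    case True
    then show ?thesis by (intro exI[of _ 1]) simp
  next
    case False
    then have "inverse z \<notin> algebra_spectrum x" using assms by simp
    then obtain y where y: "(inverse z *\<^sub>C 1 - x) * y = 1" "y * (inverse z *\<^sub>C 1 - x) = 1"
      unfolding algebra_spectrum_def by blast
    have "1 - z *\<^sub>C x = z *\<^sub>C (inverse z *\<^sub>C 1 - x)"
      using False by (simp add: scaleC_diff_right scaleC_scaleC)
    then show ?thesis
      using y False
      by (intro exI[of _ "inverse z *\<^sub>C y"]) (simp add: mult_scaleC_left mult_scaleC_right scaleC_scaleC)
  qed
  then obtain F where F: "\<And>z. F z * (1 - z *\<^sub>C x) = 1" "\<And>z. (1 - z *\<^sub>C x) * F z = 1"
    by metis
  \<comment> \<open>Since \<open>F (z * c)\<close> inverts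
    \<open>1 - z *\<^sub>C c *\<^sub>C x\<close>, the element \<open>c *\<^sub>C x\<close> has an
    everywhere defined resolvent too.\<close>
  show ?thesis
    using F[of "_ * c"]
    by (intro norm_power_less_one_of_resolvent[where F = "\<lambda>z. F (z * c)"]) (simp_all add: scaleC_scaleC)
qed

subsection \<open>The inverse square root\<close>

text \<open>Consecutive coefficients have ratio \<open>- (1/2 + m) / (m + 1)\<close>, of absolute
  value below 1. Hence the series below is dominated by the norms of the powers of its
  argument.\<close>

lemma abs_gbinomial_minus_half_le: "\<bar>(- (1/2) :: real) gchoose m\<bar> \<le> 1"
proof (induction m)
  case (Suc m)
  let ?b = "\<lambda>m. (- (1/2) :: real) gchoose m"
  have eq: "real (Suc m) * ?b (Suc m) = - ((1/2 + real m) * ?b m)"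
    using gbinomial_mult_1[of "- (1/2) :: real" m] by (simp add: algebra_simps)
  have "real (Suc m) * \<bar>?b (Suc m)\<bar> = \<bar>real (Suc m) * ?b (Suc m)\<bar>"
    by (simp only: abs_mult abs_of_nat)
  also have "\<dots> = (1 / 2 + real m) * \<bar>?b m\<bar>"
    unfolding eq abs_minus_cancel abs_mult by simp
  also have "\<dots> \<le> (1 / 2 + real m) * 1"
    by (rule mult_left_mono[OF Suc]) simp
  also have "\<dots> \<le> real (Suc m) * 1" by simp
  finally show ?case by (rule mult_left_le_imp_le) simp
qed simp

text \<open>The binomial series for the power -1/2 of \<open>1 + x\<close>; the argument is the
  deviation from 1.\<close>

definition inv_sqrt :: "'a \<Rightarrow> 'a::{real_normed_algebra_1,banach}" where
  "inv_sqrt x = (\<Sum>m. (- (1/2) gchoose m) *\<^sub>R x ^ m)"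

lemma
  fixes x :: "'a::{real_normed_algebra_1,banach}"
  assumes "summable (\<lambda>m. norm (x ^ m))"
  shows summable_norm_inv_sqrt: "summable (\<lambda>m. norm ((- (1/2) gchoose m) *\<^sub>R x ^ m))"
    and inv_sqrt_sums: "(\<lambda>m. (- (1/2) gchoose m) *\<^sub>R x ^ m) sums inv_sqrt x"
proof -
  show *: "summable (\<lambda>m. norm ((- (1/2) gchoose m) *\<^sub>R x ^ m))"
    by (rule summable_comparison_test'[OF assms, where N = 0])
      (simp add: mult_left_le_one_le abs_gbinomial_minus_half_le)
  show "(\<lambda>m. (- (1/2) gchoose m) *\<^sub>R x ^ m) sums inv_sqrt x"
    unfolding inv_sqrt_def by (rule summable_sums[OF summable_norm_cancel[OF *]])
qed

text \<open>The Vandermonde identity turns the Cauchy square of the binomial series into the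
  geometric series of \<open>- x\<close>, which inverts \<open>1 + x\<close>.\<close>

lemma inv_sqrt_square:
  fixes x :: "'a::{real_normed_algebra_1,banach}"
  assumes "summable (\<lambda>m. norm (x ^ m))"
  shows "inv_sqrt x * inv_sqrt x * (1 + x) = 1"
proof -
  let ?b = "\<lambda>m. (- (1/2) :: real) gchoose m"
  have "(\<lambda>k. \<Sum>i\<le>k. (?b i *\<^sub>R x ^ i) * (?b (k - i) *\<^sub>R x ^ (k - i))) sums (inv_sqrt x * inv_sqrt x)"
    unfolding inv_sqrt_def
    using summable_norm_inv_sqrt[OF assms] by (intro Cauchy_product_sums)
  moreover have "(\<Sum>i\<le>k. (?b i *\<^sub>R x ^ i) * (?b (k - i) *\<^sub>R x ^ (k - i))) = (- x) ^ k" for k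
  proof -
    have "(\<Sum>i\<le>k. (?b i *\<^sub>R x ^ i) * (?b (k - i) *\<^sub>R x ^ (k - i))) =
        (\<Sum>i\<le>k. (?b i * ?b (k - i)) *\<^sub>R x ^ k)"
      by (intro sum.cong) (simp_all add: power_add[symmetric])
    also have "\<dots> = ((- 1) gchoose k) *\<^sub>R x ^ k"
      using gbinomial_Vandermonde[of "- (1/2) :: real" "- (1/2)" k]
      by (simp add: scaleR_left.sum[symmetric] atMost_atLeast0)
    also have "((- 1) gchoose k) = (- 1 :: real) ^ k"
      using gbinomial_minus[of "1 :: real" k] by (simp add: binomial_gbinomial[symmetric])
    also have "(- 1) ^ k *\<^sub>R x ^ k = (- x) ^ k"
      by (simp add: power_minus[of x] scaleR_conv_of_real)
    finally show ?thesis .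
  qed
  ultimately have s: "(\<lambda>k. (- x) ^ k) sums (inv_sqrt x * inv_sqrt x)" by simp
  \<comment> \<open>The shifted series is summed twice: dropping the first term subtracts 1, while
    factoring out \<open>- x\<close> multiplies the sum.\<close>
  then have "(\<lambda>k. (- x) ^ Suc k) sums (inv_sqrt x * inv_sqrt x - 1)"
    by (subst sums_Suc_iff) simp
  moreover have "(\<lambda>k. (- x) ^ k * (- x)) sums (inv_sqrt x * inv_sqrt x * (- x))"
    by (rule sums_mult2[OF s])
  then have "(\<lambda>k. (- x) ^ Suc k) sums (inv_sqrt x * inv_sqrt x * (- x))"
    by (simp only: power_Suc2)
  ultimately have "inv_sqrt x * inv_sqrt x - 1 = inv_sqrt x * inv_sqrt x * (- x)"
    by (rule sums_unique2)
  then show ?thesis by (simp add: algebra_simps)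
qed

text \<open>\<open>T\<close> annihilates every term of the series but the constant one. It is
  applied to left and right multiplication by \<open>e\<close> and to a homomorphism.\<close>

lemma linear_inv_sqrt:
  fixes x :: "'a::{real_normed_algebra_1,banach}" and T :: "'a \<Rightarrow> 'b::real_normed_vector"
  assumes "summable (\<lambda>m. norm (x ^ m))" and T: "bounded_linear T"
    and "\<And>m. T (x ^ Suc m) = 0"
  shows "T (inv_sqrt x) = T 1"
proof -
  have "(\<lambda>m. T ((- (1/2) gchoose m) *\<^sub>R x ^ m)) sums T (inv_sqrt x)"
    by (rule bounded_linear.sums[OF T inv_sqrt_sums[OF assms(1)]])
  moreover have "T ((- (1/2) gchoose m) *\<^sub>R x ^ m) = (if m = 0 then T 1 else 0)" for m
    using assms(3)[of "m - 1"] by (cases m) (simp_all add: linear_cmul[OF bounded_linear.linear[OF T]])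
  ultimately have "(\<lambda>m. if m = 0 then T 1 else 0) sums T (inv_sqrt x)" by simp
  then show ?thesis
    using sums_single[of 0 "\<lambda>_. T 1"] by (rule sums_unique2)
qed

lemma inv_sqrt_commute:
  fixes x :: "'a::{real_normed_algebra_1,banach}"
  assumes "summable (\<lambda>m. norm (x ^ m))" and "z * x = x * z"
  shows "z * inv_sqrt x = inv_sqrt x * z"
proof -
  have "z * x ^ m = x ^ m * z" for m
    using power_commuting_commutes[of x z m] assms(2) by simp
  then have "(\<lambda>m. z * ((- (1/2) gchoose m) *\<^sub>R x ^ m)) sums (inv_sqrt x * z)"
    using sums_mult2[OF inv_sqrt_sums[OF assms(1)], of z] by simp
  with sums_mult[OF inv_sqrt_sums[OF assms(1)], of z] show ?thesis
    by (rule sums_unique2)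
qed

text \<open>Shrinking the disc carries the smallness of \<open>X 0 ^ N\<close> over to the weighted
  norm of \<open>X ^ N\<close>. The powers of \<open>X\<close> then have geometric bounds, so the
  binomial series converges in that norm.\<close>

lemma ps_bounded_inv_sqrt:
  fixes X :: "complex \<Rightarrow> 'a::complex_banach_algebra_1"
  assumes "0 < r" and X: "ps_bounded r M X" and "0 < N" and "norm (X 0 ^ N) < 1"
  obtains r' K where "0 < r'" "r' \<le> r" "ps_bounded r' K (\<lambda>w. inv_sqrt (X w))"
    and "\<And>w. w \<in> cball 0 r' \<Longrightarrow> summable (\<lambda>m. norm (X w ^ m))"
proof -
  have M: "0 \<le> M ^ N"
    using ps_bounded_nonneg[OF X] assms(1) by simp
  \<comment> \<open>Chosen so that \<open>t * M ^ N\<close> uses at most half of the gap between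
    \<open>norm (X 0 ^ N)\<close> and 1.\<close>
  define t where "t = (1 - norm (X 0 ^ N)) / (2 * (1 + M ^ N))"
  have t: "0 < t" "t \<le> 1"
    using M assms(4) by (simp_all add: t_def field_simps)
  have "t * M ^ N \<le> t * (1 + M ^ N)"
    using t(1) by (intro mult_left_mono) simp_all
  also have "\<dots> = (1 - norm (X 0 ^ N)) / 2"
    using M by (simp add: t_def del: distrib_left_numeral)
  also have "\<dots> < 1 - norm (X 0 ^ N)"
    using assms(4) by simp
  finally have lt: "norm (X 0 ^ N) + t * M ^ N < 1" by simp
  define r' where "r' = t * r"
  have r': "0 < r'" "r' \<le> r"
    using t assms(1) by (simp_all add: r'_def mult_left_le_one_le)
  have small: "ps_bounded r' (norm (X 0 ^ N) + t * M ^ N) (\<lambda>w. X w ^ N)"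
    using ps_bounded_shrink[OF ps_bounded_power[OF assms(1) X, of N], of t] t assms(1)
    by (simp add: r'_def)
  have X': "ps_bounded r' M X"
    using ps_bounded_radius_mono[OF X, of r'] r' by simp
  obtain \<rho> C where \<rho>: "0 < \<rho>" "\<rho> < 1" and C: "\<And>m. ps_bounded r' (C * \<rho> ^ m) (\<lambda>w. X w ^ m)"
  proof (rule geometric_bound_of_power_bound[of "\<lambda>m c. ps_bounded r' c (\<lambda>w. X w ^ m)"
        M N "norm (X 0 ^ N) + t * M ^ N"])
    show "ps_bounded r' (c * d) (\<lambda>w. X w ^ (m + n))"
      if "ps_bounded r' c (\<lambda>w. X w ^ m)" "ps_bounded r' d (\<lambda>w. X w ^ n)" for m n c d
      unfolding power_add by (rule ps_bounded_mult[OF r'(1) that])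
    show "ps_bounded r' d (\<lambda>w. X w ^ m)" if "ps_bounded r' c (\<lambda>w. X w ^ m)" "c \<le> d" for m c d
      using that by (rule ps_bounded_mono)
    show "ps_bounded r' 1 (\<lambda>w. X w ^ 0)"
      using ps_bounded_const[of r' "1::'a"] by simp
    show "ps_bounded r' M (\<lambda>w. X w ^ 1)" using X' by simp
  next
    fix C \<rho> assume "0 < \<rho>" "\<rho> < 1" "\<And>m. ps_bounded r' (C * \<rho> ^ m) (\<lambda>w. X w ^ m)"
    then show thesis by (rule that)
  qed (use small lt assms(3) in simp_all)
  have sC: "summable (\<lambda>m. C * \<rho> ^ m)"
    using \<rho> by (intro summable_mult summable_geometric) simp
  have C0: "0 \<le> C * \<rho> ^ m" for m
    using ps_bounded_nonneg[OF C] r'(1) by simp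
  have X_sum: "summable (\<lambda>m. norm (X w ^ m))" if "w \<in> cball 0 r'" for w
    by (rule summable_comparison_test'[OF sC, where N = 0]) (simp add: ps_bounded_norm_le[OF C that])
  have "ps_bounded r' (\<Sum>m. C * \<rho> ^ m) (\<lambda>w. inv_sqrt (X w))"
  proof (rule ps_bounded_has_sum[OF r'(1)])
    show "((\<lambda>m. C * \<rho> ^ m) has_sum (\<Sum>m. C * \<rho> ^ m)) UNIV"
      by (rule norm_summable_imp_has_sum[OF _ summable_sums[OF sC]])
        (simp only: real_norm_def abs_of_nonneg[OF C0] sC)
    show "ps_bounded r' (C * \<rho> ^ m) (\<lambda>w. (- (1/2) gchoose m) *\<^sub>R X w ^ m)" for m
    proof -
      have "ps_bounded r' (cmod (of_real (- (1/2) gchoose m)) * (C * \<rho> ^ m))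
          (\<lambda>w. of_real (- (1/2) gchoose m) *\<^sub>C X w ^ m)"
        using C by (rule ps_bounded_scaleC) (use r'(1) in simp)
      then show ?thesis
        unfolding scaleC_of_real norm_of_real
        by (rule ps_bounded_mono) (rule mult_left_le_one_le[OF C0 abs_ge_zero abs_gbinomial_minus_half_le])
    qed
    show "((\<lambda>m. (- (1/2) gchoose m) *\<^sub>R X w ^ m) has_sum inv_sqrt (X w)) UNIV" if "w \<in> cball 0 r'" for w
      using summable_norm_inv_sqrt[OF X_sum[OF that]] inv_sqrt_sums[OF X_sum[OF that]]
      by (rule norm_summable_imp_has_sum)
  qed
  then show thesis
    by (rule that[OF r' _ X_sum])
qed

subsection \<open>Lifting idempotents\<close>

text \<open>As \<open>(2f - 1)\<^sup>2 = 1 + 4(f\<^sup>2 - f)\<close>, the element \<open>(2f - 1) (1 + 4(f\<^sup>2 - f))\<^bsup>-1/2\<^esup>\<close> is an involution.\<close>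

definition idempotent_of :: "'a \<Rightarrow> 'a::{real_normed_algebra_1,banach}" where
  "idempotent_of f = (1/2) *\<^sub>R (1 + (2 *\<^sub>R f - 1) * inv_sqrt (4 *\<^sub>R (f * f - f)))"

text \<open>Half of 1 plus an involution is idempotent. The square of \<open>?s * ?h\<close> can be
  rearranged because \<open>?h\<close> is a series in an element commuting with
  \<open>f\<close>.\<close>

lemma idempotent_of_square:
  fixes f :: "'a::{real_normed_algebra_1,banach}"
  assumes "summable (\<lambda>m. norm ((4 *\<^sub>R (f * f - f)) ^ m))"
  shows "idempotent_of f * idempotent_of f = idempotent_of f"
proof -
  let ?h = "inv_sqrt (4 *\<^sub>R (f * f - f))" and ?s = "2 *\<^sub>R f - 1"
  have s: "?s * ?s = 1 + 4 *\<^sub>R (f * f - f)"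
  proof -
    have "4 *\<^sub>R f = 2 *\<^sub>R f + 2 *\<^sub>R f"
      by (simp flip: scaleR_left_distrib)
    then show ?thesis by (simp add: algebra_simps)
  qed
  have "f * ?h = ?h * f"
    by (rule inv_sqrt_commute[OF assms]) (simp add: algebra_simps)
  then have sh: "?s * ?h = ?h * ?s"
    by (simp add: left_diff_distrib right_diff_distrib)
  have "(?s * ?h) * (?s * ?h) = (?h * ?s) * (?s * ?h)"
    by (simp only: sh)
  also have "\<dots> = ?h * (?s * (?s * ?h))"
    by (simp only: mult.assoc)
  also have "\<dots> = ?h * ?h * (?s * ?s)"
    by (simp only: sh mult.assoc) (simp only: sh mult.assoc[symmetric])
  also have "\<dots> = 1"
    unfolding s by (rule inv_sqrt_square[OF assms])
  finally have "(1 + ?s * ?h) * (1 + ?s * ?h) = (1 + ?s * ?h) + (1 + ?s * ?h)"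
    by (simp only: distrib_left distrib_right mult_1_left mult_1_right add_ac)
  then show ?thesis
    unfolding idempotent_of_def by (simp flip: scaleR_2)
qed

text \<open>If \<open>e * f = 0\<close>, then \<open>e\<close> kills all positive powers of the
  argument of \<open>inv_sqrt\<close>, so multiplying the square root term by \<open>e\<close> gives
  \<open>- e\<close>, which cancels the \<open>e\<close> coming from 1. The other side is
  symmetric.\<close>

lemma idempotent_of_annihilated:
  fixes f :: "'a::{real_normed_algebra_1,banach}"
  assumes "summable (\<lambda>m. norm ((4 *\<^sub>R (f * f - f)) ^ m))"
  shows "e * f = 0 \<Longrightarrow> e * idempotent_of f = 0"
    and "f * e = 0 \<Longrightarrow> idempotent_of f * e = 0"
proof -
  let ?X = "4 *\<^sub>R (f * f - f)"
  show "e * idempotent_of f = 0" if ef: "e * f = 0"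
  proof -
    have "e * ?X = 0"
      using ef by (simp add: right_diff_distrib mult.assoc[symmetric])
    then have "e * ?X ^ Suc m = 0" for m
      by (simp only: power_Suc mult.assoc[symmetric] mult_zero_left)
    then have "e * inv_sqrt ?X = e * 1"
      by (rule linear_inv_sqrt[OF assms bounded_linear_mult_right])
    then show ?thesis
      using ef by (simp add: idempotent_of_def distrib_left left_diff_distrib right_diff_distrib mult.assoc[symmetric])
  qed
  show "idempotent_of f * e = 0" if fe: "f * e = 0"
  proof -
    have "?X * e = 0"
      using fe by (simp add: left_diff_distrib mult.assoc)
    then have "?X ^ Suc m * e = 0" for m
      by (simp only: power_Suc2 mult.assoc mult_zero_right)
    then have "inv_sqrt ?X * e = 1 * e"
      by (rule linear_inv_sqrt[OF assms bounded_linear_mult_left])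
    then show ?thesis
      using fe by (simp add: idempotent_of_def distrib_right left_diff_distrib mult.assoc)
  qed
qed

text \<open>As \<open>\<pi> f\<close> is idempotent, \<open>\<pi>\<close> kills
  \<open>f * f - f\<close> and sends the inverse square root to 1.\<close>

lemma idempotent_of_hom:
  fixes \<pi> :: "'a::complex_banach_algebra_1 \<Rightarrow>\<^sub>L 'b::complex_banach_algebra_1"
  assumes "summable (\<lambda>m. norm ((4 *\<^sub>R (f * f - f)) ^ m))"
    and hom: "unital_algebra_hom (blinfun_apply \<pi>)" and "\<pi> f * \<pi> f = \<pi> f"
  shows "\<pi> (idempotent_of f) = \<pi> f"
proof -
  let ?X = "4 *\<^sub>R (f * f - f)"
  have mult: "\<pi> (x * y) = \<pi> x * \<pi> y" and one: "\<pi> 1 = 1" for x y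
    using hom by (simp_all add: unital_algebra_hom_def)
  have "\<pi> (?X ^ Suc m) = 0" for m
    by (simp add: mult blinfun.scaleR_right blinfun.diff_right assms(3))
  then have "\<pi> (inv_sqrt ?X) = \<pi> 1"
    by (rule linear_inv_sqrt[OF assms(1) blinfun.bounded_linear_right])
  then show ?thesis
    by (simp add: idempotent_of_def mult one blinfun.scaleR_right blinfun.diff_right blinfun.add_right)
qed

lemma lift_idempotent:
  fixes \<pi> :: "complex \<Rightarrow> 'a::complex_banach_algebra_1 \<Rightarrow>\<^sub>L 'b::complex_banach_algebra_1"
  assumes "0 < R" and \<pi>: "ps_bounded R L \<pi>" and "surj (blinfun_apply (\<pi> 0))"
    and hom: "\<And>w. w \<in> cball 0 R \<Longrightarrow> unital_algebra_hom (blinfun_apply (\<pi> w))"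
    and qn: "\<And>x. \<pi> 0 x = 0 \<Longrightarrow> algebra_spectrum x = {0}"
    and q: "ps_bounded R M q" "\<And>w. w \<in> cball 0 R \<Longrightarrow> q w * q w = q w"
    and e: "ps_bounded R K e" "\<And>w. w \<in> cball 0 R \<Longrightarrow> e w * e w = e w"
    and eq: "\<And>w. w \<in> cball 0 R \<Longrightarrow> \<pi> w (e w) * q w = 0"
      "\<And>w. w \<in> cball 0 R \<Longrightarrow> q w * \<pi> w (e w) = 0"
  obtains r N p where "0 < r" and "r \<le> R" and "ps_bounded r N p"
    and "\<And>w. w \<in> cball 0 r \<Longrightarrow> p w * p w = p w"
    and "\<And>w. w \<in> cball 0 r \<Longrightarrow> e w * p w = 0"
    and "\<And>w. w \<in> cball 0 r \<Longrightarrow> p w * e w = 0"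
    and "\<And>w. w \<in> cball 0 r \<Longrightarrow> \<pi> w (p w) = q w"
proof -
  have lin: "\<pi> w (c *\<^sub>C x) = c *\<^sub>C \<pi> w x" if "w \<in> cball 0 R" for c w x
    using hom[OF that] by (simp add: unital_algebra_hom_def)
  obtain r0 N0 f0 where r0: "0 < r0" "r0 \<le> R" and f0: "ps_bounded r0 N0 f0"
    and \<pi>f0: "\<And>w. w \<in> cball 0 r0 \<Longrightarrow> \<pi> w (f0 w) = q w"
    using lift_analytic[OF assms(1) \<pi> assms(3) lin q(1)] by metis
  \<comment> \<open>The two-sided compression makes \<open>e\<close> annihilate \<open>f\<close>; it
    leaves the image unchanged because \<open>q w\<close> is orthogonal to
    \<open>\<pi> w (e w)\<close>.\<close>
  define f where "f w = (1 - e w) * f0 w * (1 - e w)" for w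
  have "ps_bounded r0 (norm (1::'a) + K) (\<lambda>w. 1 - e w)"
    using r0 by (intro ps_bounded_diff ps_bounded_const ps_bounded_radius_mono[OF e(1)]) simp_all
  from ps_bounded_mult[OF r0(1) ps_bounded_mult[OF r0(1) this f0] this]
  obtain Nf where f: "ps_bounded r0 Nf f"
    by (simp add: f_def[abs_def])
  have ef: "e w * f w = 0" and fe: "f w * e w = 0" and \<pi>f: "\<pi> w (f w) = q w"
    if w: "w \<in> cball 0 r0" for w
  proof -
    have w': "w \<in> cball 0 R" using w r0(2) by simp
    have "e w * (1 - e w) = 0" "(1 - e w) * e w = 0"
      using e(2)[OF w'] by (simp_all add: algebra_simps)
    then show "e w * f w = 0" "f w * e w = 0"
      unfolding f_def by (simp_all only: mult.assoc mult_zero_right)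
        (simp only: mult.assoc[symmetric] mult_zero_left)
    have "\<pi> w (f w) = (1 - \<pi> w (e w)) * q w * (1 - \<pi> w (e w))"
      using hom[OF w'] \<pi>f0[OF w]
      by (simp add: f_def unital_algebra_hom_def blinfun.diff_right)
    also have "\<dots> = q w"
      using eq(1)[OF w'] eq(2)[OF w'] by (simp add: algebra_simps)
    finally show "\<pi> w (f w) = q w" .
  qed
  define X where "X w = 4 *\<^sub>R (f w * f w - f w)" for w
  have ff: "ps_bounded r0 (Nf * Nf + Nf) (\<lambda>w. f w * f w - f w)"
    using r0(1) by (intro ps_bounded_diff ps_bounded_mult f) simp_all
  have X_eq: "X w = 4 *\<^sub>C (f w * f w - f w)" for w
    using scaleC_of_real[of 4 "f w * f w - f w"] by (simp add: X_def)
  have X: "ps_bounded r0 (4 * (Nf * Nf + Nf)) X"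
    using ps_bounded_scaleC[OF ff, of 4] r0(1) by (simp add: X_eq[abs_def])
  \<comment> \<open>The spectral hypothesis concerns the point \<open>0\<close> alone;
    \<open>ps_bounded_inv_sqrt\<close> spreads the resulting smallness to a disc.\<close>
  have "\<pi> 0 (f 0 * f 0 - f 0) = 0"
    using hom[of 0] \<pi>f[of 0] q(2)[of 0] r0(1) assms(1)
    by (simp add: blinfun.diff_right unital_algebra_hom_def)
  then obtain m where m: "0 < m" "norm (X 0 ^ m) < 1"
    using quasinilpotent_power_small[OF qn, of "f 0 * f 0 - f 0" 4] by (auto simp: X_eq)
  obtain r K' where r: "0 < r" "r \<le> r0" and h: "ps_bounded r K' (\<lambda>w. inv_sqrt (X w))"
    and sX: "\<And>w. w \<in> cball 0 r \<Longrightarrow> summable (\<lambda>m. norm (X w ^ m))"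
    using ps_bounded_inv_sqrt[OF r0(1) X m] by metis
  have s: "summable (\<lambda>m. norm ((4 *\<^sub>R (f w * f w - f w)) ^ m))" if "w \<in> cball 0 r" for w
    using sX[OF that] by (simp only: X_def)
  have f': "ps_bounded r Nf f"
    using ps_bounded_radius_mono[OF f, of r] r by simp
  have "ps_bounded r (1/2 * (norm (1::'a) + (2 * Nf + norm (1::'a)) * K'))
    (\<lambda>w. complex_of_real (1/2) *\<^sub>C (1 + (complex_of_real 2 *\<^sub>C f w - 1) * inv_sqrt (X w)))"
    using ps_bounded_scaleC[OF ps_bounded_add[OF ps_bounded_const[of r "1::'a"] ps_bounded_mult[OF r(1)
          ps_bounded_diff[OF ps_bounded_scaleC[OF f', of "complex_of_real 2"] ps_bounded_const[of r "1::'a"]] h]],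
        of "complex_of_real (1/2)"] r(1)
    by (simp add: norm_divide)
  then obtain N where N: "ps_bounded r N (\<lambda>w. idempotent_of (f w))"
    unfolding scaleC_of_real by (auto simp: idempotent_of_def X_def[abs_def])
  show thesis
  proof (rule that[OF r(1) _ N])
    show "r \<le> R" using r(2) r0(2) by simp
    fix w :: complex assume w: "w \<in> cball 0 r"
    then have w0: "w \<in> cball 0 r0" and wR: "w \<in> cball 0 R" using r(2) r0(2) by simp_all
    show "idempotent_of (f w) * idempotent_of (f w) = idempotent_of (f w)"
      by (rule idempotent_of_square[OF s[OF w]])
    show "e w * idempotent_of (f w) = 0" "idempotent_of (f w) * e w = 0"
      by (rule idempotent_of_annihilated[OF s[OF w]], rule ef[OF w0] fe[OF w0])+
    show "\<pi> w (idempotent_of (f w)) = q w"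
      using idempotent_of_hom[OF s[OF w] hom[OF wR]] q(2)[OF wR] by (simp add: \<pi>f[OF w0])
  qed
qed

section \<open>Finite orthogonal families of idempotents\<close>

theorem theorem5:
  fixes U :: "complex set"
    and \<pi> :: "complex \<Rightarrow> 'a::complex_banach_algebra_1 \<Rightarrow>\<^sub>L 'b::complex_banach_algebra_1"
    and n :: nat
    and q :: "nat \<Rightarrow> complex \<Rightarrow> 'b"
  assumes "open U" and "0 \<in> U"
    and "analytic_map_on \<pi> U"
    and "\<And>z. z \<in> U \<Longrightarrow> unital_algebra_hom (blinfun_apply (\<pi> z))"
    and "surj (blinfun_apply (\<pi> 0))"
    and "\<And>x. blinfun_apply (\<pi> 0) x = 0 \<Longrightarrow> algebra_spectrum x = {0}"
    and "\<And>i. i \<in> {1..n} \<Longrightarrow> analytic_map_on (q i) U"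
    and "\<And>i z. i \<in> {1..n} \<Longrightarrow> z \<in> U \<Longrightarrow> q i z \<in> idempotents"
    and "\<And>i j z. i \<in> {1..n} \<Longrightarrow> j \<in> {1..n} \<Longrightarrow> i \<noteq> j \<Longrightarrow> z \<in> U \<Longrightarrow>
           orthogonal_idempotents (q i z) (q j z)"
  shows "\<exists>(V :: complex set) (p :: nat \<Rightarrow> complex \<Rightarrow> 'a).
           open V \<and> 0 \<in> V \<and> V \<subseteq> U \<and>
           (\<forall>i\<in>{1..n}. analytic_map_on (p i) V) \<and>
           (\<forall>i\<in>{1..n}. \<forall>z\<in>V. p i z \<in> idempotents) \<and>
           (\<forall>i\<in>{1..n}. \<forall>j\<in>{1..n}. i \<noteq> j \<longrightarrow> (\<forall>z\<in>V. orthogonal_idempotents (p i z) (p j z))) \<and>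
           (\<forall>i\<in>{1..n}. \<forall>z\<in>V. blinfun_apply (\<pi> z) (p i z) = q i z)"
proof -
  obtain r1 L where r1: "0 < r1" and \<pi>: "ps_bounded r1 L \<pi>"
    using analytic_imp_ps_bounded[OF assms(3,2)] by metis
  \<comment> \<open>Induction on the number \<open>k\<close> of lifted idempotents, with a radius
    that may shrink at each stage. One order of the product is enough in the last clause, as
    \<open>i\<close> and \<open>j\<close> may be exchanged.\<close>
  have "\<exists>r p. 0 < r \<and> cball 0 r \<subseteq> U \<and> (\<forall>i\<in>{1..k}. \<exists>M. ps_bounded r M (p i)) \<and>
    (\<forall>i\<in>{1..k}. \<forall>w\<in>cball 0 r. p i w * p i w = p i w \<and> \<pi> w (p i w) = q i w) \<and>
    (\<forall>i\<in>{1..k}. \<forall>j\<in>{1..k}. i \<noteq> j \<longrightarrow> (\<forall>w\<in>cball 0 r. p i w * p j w = 0))"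
    if "k \<le> n" for k
    using that
  proof (induction k)
    case 0
    obtain r where "0 < r" "cball 0 r \<subseteq> U"
      using assms(1,2) open_contains_cball by blast
    then show ?case by (intro exI[of _ r] conjI) simp_all
  next
    case (Suc k)
    then obtain r p where r: "0 < r" "cball 0 r \<subseteq> U"
      and p: "\<forall>i\<in>{1..k}. \<exists>M. ps_bounded r M (p i)"
      and pp: "\<And>i w. i \<in> {1..k} \<Longrightarrow> w \<in> cball 0 r \<Longrightarrow> p i w * p i w = p i w"
      and \<pi>p: "\<And>i w. i \<in> {1..k} \<Longrightarrow> w \<in> cball 0 r \<Longrightarrow> \<pi> w (p i w) = q i w"
      and orth: "\<And>i j w. i \<in> {1..k} \<Longrightarrow> j \<in> {1..k} \<Longrightarrow> i \<noteq> j \<Longrightarrow> w \<in> cball 0 r \<Longrightarrow>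
        p i w * p j w = 0"
      by auto
    obtain M where "\<forall>i\<in>{1..k}. ps_bounded r (M i) (p i)"
      using bchoice[OF p] by (rule exE)
    note M = this[rule_format]
    have k: "Suc k \<in> {1..n}" using Suc.prems by simp
    obtain r2 Mq where r2: "0 < r2" and q: "ps_bounded r2 Mq (q (Suc k))"
      using analytic_imp_ps_bounded[OF assms(7)[OF k] assms(2)] by metis
    define R where "R = min r (min r1 r2)"
    have R: "0 < R" "R \<le> r" "R \<le> r1" "R \<le> r2"
      using r(1) r1 r2 by (simp_all add: R_def)
    have RU: "w \<in> U" and Rr: "w \<in> cball 0 r" if "w \<in> cball 0 R" for w
      using that R(2) r(2) by auto
    have kn: "i \<in> {1..n}" "i \<noteq> Suc k" if "i \<in> {1..k}" for i
      using that Suc.prems by auto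
    have qq: "q i w * q i w = q i w" if "i \<in> {1..n}" "w \<in> U" for i w
      using assms(8)[OF that] by (simp add: idempotents_def power2_eq_square)
    \<comment> \<open>A sum of pairwise orthogonal idempotents is an idempotent that acts as a unit
      on each summand.\<close>
    define e where "e w = (\<Sum>i\<in>{1..k}. p i w)" for w
    have e: "ps_bounded R (\<Sum>i\<in>{1..k}. M i) e"
      unfolding e_def[abs_def] using R(1,2)
      by (intro ps_bounded_sum ps_bounded_radius_mono[OF M]) simp_all
    have pe: "p i w * e w = p i w" "e w * p i w = p i w" if "i \<in> {1..k}" "w \<in> cball 0 r" for i w
    proof -
      have "p i w * p j w = (if j = i then p i w else 0)" "p j w * p i w = (if j = i then p i w else 0)"
        if "j \<in> {1..k}" for j
        using pp orth \<open>i \<in> {1..k}\<close> \<open>w \<in> cball 0 r\<close> that by auto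
      then show "p i w * e w = p i w" "e w * p i w = p i w"
        using that(1) unfolding e_def sum_distrib_left sum_distrib_right by simp_all
    qed
    have ee: "e w * e w = e w" if "w \<in> cball 0 R" for w
      using pe(1)[OF _ Rr[OF that]] unfolding e_def[of w] sum_distrib_right by (simp add: e_def)
    have \<pi>e: "\<pi> w (e w) = (\<Sum>i\<in>{1..k}. q i w)" if "w \<in> cball 0 R" for w
      unfolding e_def blinfun.sum_right using \<pi>p[OF _ Rr[OF that]] by simp
    have qo: "q i w * q (Suc k) w = 0" "q (Suc k) w * q i w = 0" if "i \<in> {1..k}" "w \<in> U" for i w
      using assms(9)[OF kn(1)[OF that(1)] k kn(2)[OF that(1)] that(2)]
      by (simp_all add: orthogonal_idempotents_def)
    have eq: "\<pi> w (e w) * q (Suc k) w = 0" "q (Suc k) w * \<pi> w (e w) = 0" if "w \<in> cball 0 R" for w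
      unfolding \<pi>e[OF that] sum_distrib_left sum_distrib_right
      using qo[OF _ RU[OF that]] by simp_all
    obtain s N p' where s: "0 < s" "s \<le> R" and p': "ps_bounded s N p'"
      "\<And>w. w \<in> cball 0 s \<Longrightarrow> p' w * p' w = p' w"
      "\<And>w. w \<in> cball 0 s \<Longrightarrow> e w * p' w = 0" "\<And>w. w \<in> cball 0 s \<Longrightarrow> p' w * e w = 0"
      "\<And>w. w \<in> cball 0 s \<Longrightarrow> \<pi> w (p' w) = q (Suc k) w"
      using lift_idempotent[OF R(1) ps_bounded_radius_mono[OF \<pi> _ R(3)] assms(5) assms(4)[OF RU]
          assms(6) ps_bounded_radius_mono[OF q _ R(4)] qq[OF k RU] e ee eq] R(1)
      by auto
    have sr: "w \<in> cball 0 r" if "w \<in> cball 0 s" for w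
      using that s(2) R(2) by simp
    \<comment> \<open>Being annihilated by \<open>e\<close> passes to each \<open>p i\<close>,
      because \<open>e\<close> can be inserted next to \<open>p i\<close> in the product.\<close>
    have po: "p i w * p' w = 0" "p' w * p i w = 0" if i: "i \<in> {1..k}" and w: "w \<in> cball 0 s" for i w
    proof -
      have "p i w * p' w = p i w * (e w * p' w)"
        using pe(1)[OF i sr[OF w]] by (simp add: mult.assoc[symmetric])
      then show "p i w * p' w = 0" by (simp add: p'(3)[OF w])
      have "p' w * p i w = (p' w * e w) * p i w"
        using pe(2)[OF i sr[OF w]] by (simp add: mult.assoc)
      then show "p' w * p i w = 0" by (simp add: p'(4)[OF w])
    qed
    let ?p = "p(Suc k := p')"
    have p_old: "?p i = p i" if "i \<in> {1..k}" for i
      using that by auto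
    have split: "i \<in> {1..Suc k} \<longleftrightarrow> i = Suc k \<or> i \<in> {1..k}" for i by auto
    show ?case
    proof (rule exI[of _ s], rule exI[of _ ?p], intro conjI ballI impI)
      show "0 < s" by (rule s(1))
      show "cball 0 s \<subseteq> U" using sr r(2) by blast
      fix i assume i: "i \<in> {1..Suc k}"
      show "\<exists>M. ps_bounded s M (?p i)"
        using i p'(1) ps_bounded_radius_mono[OF M, of i s] s R(2) unfolding split
        by (auto simp: p_old)
      fix w :: complex assume w: "w \<in> cball 0 s"
      show "?p i w * ?p i w = ?p i w" "\<pi> w (?p i w) = q i w"
        using i p'(2,5)[OF w] pp[OF _ sr[OF w]] \<pi>p[OF _ sr[OF w]] unfolding split
        by (auto simp: p_old)
      fix j assume "j \<in> {1..Suc k}" "i \<noteq> j"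
      then show "?p i w * ?p j w = 0"
        using i po[OF _ w] orth[OF _ _ _ sr[OF w]] unfolding split
        by (auto simp: p_old)
    qed
  qed
  then obtain r p where r: "0 < r" "cball 0 r \<subseteq> U" and p: "\<forall>i\<in>{1..n}. \<exists>M. ps_bounded r M (p i)"
    and idem: "\<forall>i\<in>{1..n}. \<forall>w\<in>cball 0 r. p i w * p i w = p i w \<and> \<pi> w (p i w) = q i w"
    and orth: "\<forall>i\<in>{1..n}. \<forall>j\<in>{1..n}. i \<noteq> j \<longrightarrow> (\<forall>w\<in>cball 0 r. p i w * p j w = 0)"
    by blast
  show ?thesis
  \<comment> \<open>The open ball serves as \<open>V\<close>: each of its points has room for a
    re-expansion, which the boundary of the closed disc would not provide.\<close>
  proof (intro exI[of _ "ball 0 r"] exI[of _ p] conjI ballI impI)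
    show "0 \<in> ball (0::complex) r" using r(1) by simp
    show "ball 0 r \<subseteq> U" using r(2) ball_subset_cball by blast
    show "analytic_map_on (p i) (ball 0 r)" if "i \<in> {1..n}" for i
      using bspec[OF p that] by (elim exE) (rule ps_bounded_imp_analytic)
    fix i and z :: complex assume i: "i \<in> {1..n}" and z: "z \<in> ball 0 r"
    then show "p i z \<in> idempotents" "\<pi> z (p i z) = q i z"
      using idem by (auto simp: idempotents_def power2_eq_square)
  next
    fix i j and z :: complex assume "i \<in> {1..n}" "j \<in> {1..n}" "i \<noteq> j" "z \<in> ball 0 r"
    then show "orthogonal_idempotents (p i z) (p j z)"
      using orth by (auto simp: orthogonal_idempotents_def)
  qed simp
qed

end
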